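(* Let $\alpha,\beta>-1$ and $n\in\mathbb N_0$. Define the polynomial spaces (a) $\mathcal U_n^2(W_{\alpha,\beta,-1})=(1-x-y)\mathcal V_{n-1}^2(W_{\alpha,\beta,1})+H_{n,3}(w_{\alpha,\beta})$ for $n\ge0$; (b) $\mathcal U_0^2(W_{\alpha,-1,-1})=\mathrm{span}\{1\}$ and, for $n\ge1$, $\mathcal U_n^2(W_{\alpha,-1,-1})=y(1-x-y)\mathcal V_{n-2}^2(W_{\alpha,1,1})+y\,H_{n-1,3}(w_{\alpha,1})+(1-x-y)H_{n-1,2}(w_{1,\alpha})$; (c) $\mathcal U_0^2(W_{-1,-1,-1})=\mathrm{span}\{1\}$, $\mathcal U_1^2(W_{-1,-1,-1})=\mathrm{span}\{x+c_1,y+c_2\}$ with $c_1,c_2$ arbitrary real constants, and for $n\ge2$, $\mathcal U_n^2(W_{-1,-1,-1})=xy(1-x-y)\mathcal V_{n-3}^2(W_{1,1,1})+xy\,H_{n-2,3}(w_{1,1})+x(1-x-y)H_{n-2,2}(w_{1,1})+y(1-x-y)H_{n-2,1}(w_{1,1})$. Then, in each case (a), (b), (c) with $(a',b',c')$ equal to $(\alpha,\beta,-1)$, $(\alpha,-1,-1)$, $(-1,-1,-1)$ respectively, every element of $\mathcal U_n^2(W_{a',b',c'})$ is a polynomial solution of $L_{a',b',c'}u=-n(n+a'+b'+c'+2)u$, the space $\mathcal U_n^2(W_{a',b',c'})$ consists of polynomials of degree $n$ and has dimension $n+1$, and the sums defining it are direct.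
   Context: $T^2=\{(x,y):x,y\ge0,\ 1-x-y\ge0\}$, $W_{a,b,c}(x,y)=x^ay^b(1-x-y)^c$. For $a,b,c>-1$, $\mathcal V_m^2(W_{a,b,c})$ is the space of polynomials of degree $m$ orthogonal in $L^2(W_{a,b,c},T^2)$ to all polynomials of degree $\le m-1$; $\mathcal V_m^2=\{0\}$ and $H_{m,i}=\{0\}$ if $m<0$. The operator is $L_{a,b,c}u=x(1-x)u_{xx}-2xyu_{xy}+y(1-y)u_{yy}+(a+1-(a+b+c+3)x)u_x+(b+1-(a+b+c+3)y)u_y$. For $a,b>-1$ and $m\ge0$ let $p_m^{(b,a)}(s,t)=t^{-b}(1-s-t)^{-a}\frac{\partial^m}{\partial t^m}\big[t^{b+m}(1-s-t)^{a+m}\big]$ (a polynomial in $(s,t)$), and define the one-dimensional spaces $H_{m,1}(w_{a,b})=\mathrm{span}\{p_m^{(b,a)}(x,y)\}$, $H_{m,2}(w_{a,b})=\mathrm{span}\{p_m^{(b,a)}(y,x)\}$, $H_{m,3}(w_{a,b})=\mathrm{span}\{p_m^{(b,a)}(1-x-y,y)\}$. *)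

theory Defs
  imports "HOL-Analysis.Analysis"
begin

type_synonym bfun = "real \<Rightarrow> real \<Rightarrow> real"

definition poly_le :: "nat \<Rightarrow> bfun \<Rightarrow> bool" where
  "poly_le m f \<longleftrightarrow> (\<exists>c :: nat \<Rightarrow> nat \<Rightarrow> real. \<forall>x y.
      f x y = (\<Sum>i\<le>m. \<Sum>j\<le>m - i. c i j * x ^ i * y ^ j))"

definition T2 :: "(real \<times> real) set" where
  "T2 = {(x, y). x \<ge> 0 \<and> y \<ge> 0 \<and> 1 - x - y \<ge> 0}"

definition W :: "real \<Rightarrow> real \<Rightarrow> real \<Rightarrow> real \<Rightarrow> real \<Rightarrow> real" where
  "W a b c x y = x powr a * y powr b * (1 - x - y) powr c"

definition Vsp :: "int \<Rightarrow> real \<Rightarrow> real \<Rightarrow> real \<Rightarrow> bfun set" where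
  "Vsp m a b c = (if m < 0 then {\<lambda>x y. 0} else
     {f. poly_le (nat m) f \<and>
        (\<forall>g. m \<ge> 1 \<and> poly_le (nat m - 1) g \<longrightarrow>
           (LINT p:T2|lborel. W a b c (fst p) (snd p) * f (fst p) (snd p) * g (fst p) (snd p)) = 0)})"

text \<open>Polynomials representing p_m^{(bb,aa)}(s,t): polynomials of degree at most m agreeing with
  t^{-bb}(1-s-t)^{-aa} d^m/dt^m [t^{bb+m}(1-s-t)^{aa+m}] wherever t>0 and 1-s-t>0.\<close>
definition pset :: "nat \<Rightarrow> real \<Rightarrow> real \<Rightarrow> bfun set" where
  "pset m bb aa = {f. poly_le m f \<and>
     (\<forall>s t. 0 < t \<and> 0 < 1 - s - t \<longrightarrow>
        f s t = t powr (- bb) * (1 - s - t) powr (- aa) *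
          (deriv ^^ m) (\<lambda>\<tau>. \<tau> powr (bb + real m) * (1 - s - \<tau>) powr (aa + real m)) t)}"

definition H1 :: "int \<Rightarrow> real \<Rightarrow> real \<Rightarrow> bfun set" where
  "H1 m a b = (if m < 0 then {\<lambda>x y. 0} else
     {\<lambda>x y. k * f x y | k f. f \<in> pset (nat m) b a})"

definition H2 :: "int \<Rightarrow> real \<Rightarrow> real \<Rightarrow> bfun set" where
  "H2 m a b = (if m < 0 then {\<lambda>x y. 0} else
     {\<lambda>x y. k * f y x | k f. f \<in> pset (nat m) b a})"

definition H3 :: "int \<Rightarrow> real \<Rightarrow> real \<Rightarrow> bfun set" where
  "H3 m a b = (if m < 0 then {\<lambda>x y. 0} else
     {\<lambda>x y. k * f (1 - x - y) y | k f. f \<in> pset (nat m) b a})"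

definition dx :: "bfun \<Rightarrow> bfun" where
  "dx u x y = deriv (\<lambda>s. u s y) x"

definition dy :: "bfun \<Rightarrow> bfun" where
  "dy u x y = deriv (\<lambda>t. u x t) y"

definition Lop :: "real \<Rightarrow> real \<Rightarrow> real \<Rightarrow> bfun \<Rightarrow> bfun" where
  "Lop a b c u x y =
     x * (1 - x) * dx (dx u) x y - 2 * x * y * dy (dx u) x y + y * (1 - y) * dy (dy u) x y
     + (a + 1 - (a + b + c + 3) * x) * dx u x y + (b + 1 - (a + b + c + 3) * y) * dy u x y"

definition mulsp :: "bfun \<Rightarrow> bfun set \<Rightarrow> bfun set" where
  "mulsp h A = {\<lambda>x y. h x y * f x y | f. f \<in> A}"

definition sumsp :: "bfun set list \<Rightarrow> bfun set" where
  "sumsp As = {(\<lambda>x y. \<Sum>i<length As. (fs ! i) x y) | fs.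
      length fs = length As \<and> (\<forall>i<length As. fs ! i \<in> As ! i)}"

definition direct :: "bfun set list \<Rightarrow> bool" where
  "direct As \<longleftrightarrow> (\<forall>fs. length fs = length As \<and> (\<forall>i<length As. fs ! i \<in> As ! i)
      \<and> (\<forall>x y. (\<Sum>i<length As. (fs ! i) x y) = 0)
      \<longrightarrow> (\<forall>i<length As. fs ! i = (\<lambda>x y. 0)))"

definition has_dim :: "bfun set \<Rightarrow> nat \<Rightarrow> bool" where
  "has_dim U k \<longleftrightarrow> (\<exists>bs :: bfun list. length bs = k \<and> (\<forall>i<k. bs ! i \<in> U)
     \<and> (\<forall>cs :: real list. length cs = k \<and> (\<forall>x y. (\<Sum>i<k. cs ! i * (bs ! i) x y) = 0)
           \<longrightarrow> (\<forall>i<k. cs ! i = 0))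
     \<and> U = {(\<lambda>x y. \<Sum>i<k. cs ! i * (bs ! i) x y) | cs. length cs = k})"

definition Uprops :: "nat \<Rightarrow> real \<Rightarrow> real \<Rightarrow> real \<Rightarrow> bfun set \<Rightarrow> bool" where
  "Uprops n a b c U \<longleftrightarrow>
     (\<forall>u\<in>U. poly_le n u \<and>
        (\<forall>x y. Lop a b c u x y = - (real n * (real n + a + b + c + 2)) * u x y))
   \<and> (\<forall>u\<in>U. u \<noteq> (\<lambda>x y. 0) \<longrightarrow> (\<forall>m<n. \<not> poly_le m u))
   \<and> has_dim U (n + 1)"

definition Ua_list :: "real \<Rightarrow> real \<Rightarrow> nat \<Rightarrow> bfun set list" where
  "Ua_list \<alpha> \<beta> n = [mulsp (\<lambda>x y. 1 - x - y) (Vsp (int n - 1) \<alpha> \<beta> 1), H3 (int n) \<alpha> \<beta>]"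

definition Ub_list :: "real \<Rightarrow> nat \<Rightarrow> bfun set list" where
  "Ub_list \<alpha> n = [mulsp (\<lambda>x y. y * (1 - x - y)) (Vsp (int n - 2) \<alpha> 1 1),
                   mulsp (\<lambda>x y. y) (H3 (int n - 1) \<alpha> 1),
                   mulsp (\<lambda>x y. 1 - x - y) (H2 (int n - 1) 1 \<alpha>)]"

definition Uc_list :: "nat \<Rightarrow> bfun set list" where
  "Uc_list n = [mulsp (\<lambda>x y. x * y * (1 - x - y)) (Vsp (int n - 3) 1 1 1),
                mulsp (\<lambda>x y. x * y) (H3 (int n - 2) 1 1),
                mulsp (\<lambda>x y. x * (1 - x - y)) (H2 (int n - 2) 1 1),
                mulsp (\<lambda>x y. y * (1 - x - y)) (H1 (int n - 2) 1 1)]"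

definition Ua :: "real \<Rightarrow> real \<Rightarrow> nat \<Rightarrow> bfun set" where
  "Ua \<alpha> \<beta> n = sumsp (Ua_list \<alpha> \<beta> n)"

definition Ub :: "real \<Rightarrow> nat \<Rightarrow> bfun set" where
  "Ub \<alpha> n = (if n = 0 then {\<lambda>x y. k | k. True} else sumsp (Ub_list \<alpha> n))"

definition Uc :: "real \<Rightarrow> real \<Rightarrow> nat \<Rightarrow> bfun set" where
  "Uc c1 c2 n = (if n = 0 then {\<lambda>x y. k | k. True}
     else if n = 1 then {\<lambda>x y. k1 * (x + c1) + k2 * (y + c2) | k1 k2. True}
     else sumsp (Uc_list n))"

end

theory Submission
  imports Defs
begin

text \<open>The operator acts on monomials by
  \<open>Lop (x^i y^j) = - eigval (i + j) x^i y^j + i (i + a) x^(i-1) y^j + j (j + b) x^i y^(j-1)\<close>,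
  so it is triangular with respect to the degree and its eigenspaces can be treated algebraically.
  For \<open>a, b, c > -1\<close> the moments of the weight are Dirichlet integrals; their recurrences make \<open>Lop\<close>
  symmetric, whence the orthogonal space of degree \<open>m\<close> is exactly the eigenspace for \<open>eigval m\<close>
  and has dimension \<open>m + 1\<close>. Multiplication by a barycentric coordinate maps eigenfunctions
  for the exponent \<open>1\<close> to eigenfunctions for the exponent \<open>-1\<close>. The Rodrigues polynomials
  become homogeneous in two barycentric coordinates and are then eigenfunctions whatever the third
  exponent is. All summands therefore lie in one eigenspace; restriction to the edges of the
  triangle separates them, and a nonzero eigenfunction cannot have lower degree because the
  eigenvalues are distinct.\<close>

section \<open>Bivariate polynomials\<close>



text \<open>A weight with an exponent -1 is not integrable over \<open>T2\<close>, so the spaces of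
  the theorem cannot be described by orthogonality; it serves only to identify the factors
  \<open>Vsp\<close>, whose exponents exceed -1, with eigenspaces. Symmetry of \<open>Lop\<close> is
  read off the moments rather than from Green's formula, so no boundary terms have to be controlled
  for exponents between -1 and 0. Distinctness of the eigenvalues is the critical point: the
  difference of \<open>eigval\<close> at n and at k is (n - k) (k + n + a + b + c + 2). For k < n it
  vanishes in the three families only when a = b = c = -1, n = 1, k = 0. There constants share the
  eigenvalue 0 of the linear polynomials, which explains the free constants \<open>c1\<close>,
  \<open>c2\<close> and the separate treatment of that space. Since each coordinate factor raises
  the degree by one, the dimensions add up to n + 1, (n - 1) + 1 + 1 and (n - 2) + 1 + 1 + 1. To
  separate the summands, vertices of the triangle suffice in (a) and (b); in (c) all edge summands
  vanish at every vertex, so whole open edges are used.\<close>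

text \<open>Strict degree bound, so that degree \<open>0\<close> has the proper lower space \<open>plt 0\<close>, the zero space.\<close>

definition plt :: "nat \<Rightarrow> bfun \<Rightarrow> bool" where
  "plt m f \<longleftrightarrow> (\<exists>c :: nat \<Rightarrow> nat \<Rightarrow> real. \<forall>x y.
      f x y = (\<Sum>i<m. \<Sum>j<m - i. c i j * x ^ i * y ^ j))"

lemma poly_le_iff_plt: "poly_le m f \<longleftrightarrow> plt (Suc m) f"
proof -
  have "(\<Sum>i\<le>m. \<Sum>j\<le>m - i. F i j) = (\<Sum>i<Suc m. \<Sum>j<Suc m - i. F i j)"
    for F :: "nat \<Rightarrow> nat \<Rightarrow> real"
    by (rule sum.cong) (auto simp: Suc_diff_le lessThan_Suc_atMost)
  then show ?thesis unfolding poly_le_def plt_def by simp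
qed

lemma plt_0: "plt 0 f \<longleftrightarrow> f = (\<lambda>x y. 0)"
  unfolding plt_def by (auto simp: fun_eq_iff)

lemma plt_zero: "plt m (\<lambda>x y. 0)"
  unfolding plt_def by (intro exI[of _ "\<lambda>i j. 0"]) simp

lemma plt_monomial:
  assumes "i + j < m"
  shows "plt m (\<lambda>x y. x ^ i * y ^ j)"
proof -
  define c :: "nat \<Rightarrow> nat \<Rightarrow> real" where "c i' j' = (if i' = i then if j' = j then 1 else 0 else 0)" for i' j'
  have "(\<Sum>i'<m. \<Sum>j'<m - i'. c i' j' * x ^ i' * y ^ j') = x ^ i * y ^ j" for x y
  proof -
    have "(\<Sum>i'<m. \<Sum>j'<m - i'. c i' j' * x ^ i' * y ^ j')
      = (\<Sum>i'<m. if i' = i then (\<Sum>j'<m - i. if j' = j then x ^ i * y ^ j else 0) else 0)"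
    proof (rule sum.cong)
      fix i' assume "i' \<in> {..<m}"
      show "(\<Sum>j'<m - i'. c i' j' * x ^ i' * y ^ j') =
          (if i' = i then (\<Sum>j'<m - i. if j' = j then x ^ i * y ^ j else 0) else 0)"
      proof (cases "i' = i")
        case True
        have "(\<Sum>j'<m - i'. c i' j' * x ^ i' * y ^ j') = (\<Sum>j'<m - i. if j' = j then x ^ i * y ^ j else 0)"
          unfolding True by (rule sum.cong) (simp_all add: c_def)
        then show ?thesis using True by simp
      qed (simp add: c_def)
    qed simp
    also have "\<dots> = x ^ i * y ^ j"
      using assms by auto
    finally show ?thesis .
  qed
  then show ?thesis unfolding plt_def by (intro exI[of _ c]) simp
qed

lemma plt_add:
  assumes "plt m f" "plt m g"
  shows "plt m (\<lambda>x y. f x y + g x y)"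
proof -
  from assms obtain c d where
    "\<forall>x y. f x y = (\<Sum>i<m. \<Sum>j<m - i. c i j * x ^ i * y ^ j)"
    "\<forall>x y. g x y = (\<Sum>i<m. \<Sum>j<m - i. d i j * x ^ i * y ^ j)" unfolding plt_def by blast
  then show ?thesis unfolding plt_def
    by (intro exI[of _ "\<lambda>i j. c i j + d i j"]) (simp add: sum.distrib algebra_simps)
qed

lemma plt_scale:
  assumes "plt m f"
  shows "plt m (\<lambda>x y. k * f x y)"
proof -
  from assms obtain c where
    "\<forall>x y. f x y = (\<Sum>i<m. \<Sum>j<m - i. c i j * x ^ i * y ^ j)" unfolding plt_def by blast
  then show ?thesis unfolding plt_def
    by (intro exI[of _ "\<lambda>i j. k * c i j"]) (simp add: sum_distrib_left mult.assoc)
qed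

lemma plt_diff: "plt m f \<Longrightarrow> plt m g \<Longrightarrow> plt m (\<lambda>x y. f x y - g x y)"
  using plt_add[of m f "\<lambda>x y. (-1) * g x y"] plt_scale[of m g "-1"] by simp

lemma plt_sum:
  "finite S \<Longrightarrow> (\<And>s. s \<in> S \<Longrightarrow> plt m (F s)) \<Longrightarrow> plt m (\<lambda>x y. \<Sum>s\<in>S. F s x y)"
  by (induction S rule: finite_induct) (auto simp: plt_zero intro: plt_add)

text \<open>Reduces claims that are linear in the polynomial to monomials within the degree
  bound.\<close>

lemma plt_induct [consumes 1, case_names monomial zero add scale]:
  assumes "plt m f"
    and mon: "\<And>i j. i + j < m \<Longrightarrow> Q (\<lambda>x y. x ^ i * y ^ j)"
    and zero: "Q (\<lambda>x y. 0)"
    and add: "\<And>f g. Q f \<Longrightarrow> Q g \<Longrightarrow> Q (\<lambda>x y. f x y + g x y)"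
    and scale: "\<And>k f. Q f \<Longrightarrow> Q (\<lambda>x y. k * f x y)"
  shows "Q f"
proof -
  have Qsum: "finite S \<Longrightarrow> (\<And>s. s \<in> S \<Longrightarrow> Q (F s)) \<Longrightarrow> Q (\<lambda>x y. \<Sum>s\<in>S. F s x y)"
    for S :: "nat set" and F
    by (induction S rule: finite_induct) (auto simp: zero intro: add)
  from assms(1) obtain c where
    c: "\<forall>x y. f x y = (\<Sum>i<m. \<Sum>j<m - i. c i j * x ^ i * y ^ j)" unfolding plt_def by blast
  have "Q (\<lambda>x y. \<Sum>i<m. \<Sum>j<m - i. c i j * (x ^ i * y ^ j))"
    by (intro Qsum scale mon) auto
  moreover have "f = (\<lambda>x y. \<Sum>i<m. \<Sum>j<m - i. c i j * (x ^ i * y ^ j))"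
    using c by (auto simp: fun_eq_iff mult.assoc)
  ultimately show ?thesis by simp
qed

lemma plt_mono: "plt m f \<Longrightarrow> m \<le> n \<Longrightarrow> plt n f"
  by (induction rule: plt_induct) (auto intro: plt_monomial plt_zero plt_add plt_scale)

lemma plt_mult:
  assumes "plt (Suc m) f" "plt (Suc n) g"
  shows "plt (Suc (m + n)) (\<lambda>x y. f x y * g x y)"
  using assms(1)
proof (induction rule: plt_induct)
  case (monomial i j)
  show ?case using assms(2)
  proof (induction rule: plt_induct)
    case (monomial k l)
    have "plt (Suc (m + n)) (\<lambda>x y. x ^ (i + k) * y ^ (j + l))"
      using \<open>i + j < Suc m\<close> \<open>k + l < Suc n\<close> by (intro plt_monomial) simp
    then show ?case by (simp add: power_add algebra_simps)
  next
    case (add f g)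
    then show ?case using plt_add[OF add] by (simp add: algebra_simps)
  next
    case (scale k f)
    then show ?case using plt_scale[OF scale, of k] by (simp add: algebra_simps)
  qed (simp add: plt_zero)
next
  case (add f g')
  then show ?case using plt_add[OF add] by (simp add: algebra_simps)
next
  case (scale k f)
  then show ?case using plt_scale[OF scale, of k] by (simp add: algebra_simps)
qed (simp add: plt_zero)

lemma plt_const: "plt (Suc m) (\<lambda>x y. k)"
  using plt_scale[OF plt_monomial[of 0 0 "Suc m"], of k] by simp

lemma plt_x: "plt (Suc (Suc m)) (\<lambda>x y. x)"
  using plt_monomial[of 1 0 "Suc (Suc m)"] by simp

lemma plt_y: "plt (Suc (Suc m)) (\<lambda>x y. y)"
  using plt_monomial[of 0 1 "Suc (Suc m)"] by simp

lemma plt_z: "plt (Suc (Suc m)) (\<lambda>x y. 1 - x - y)"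
  by (intro plt_diff plt_const plt_x plt_y)

lemma plt_power:
  assumes "plt (Suc (Suc 0)) f"
  shows "plt (Suc n) (\<lambda>x y. f x y ^ n)"
proof (induction n)
  case (Suc n)
  then show ?case using plt_mult[OF assms Suc] by simp
qed (simp add: plt_const)

section \<open>Polynomials without a degree bound\<close>

definition poly2 :: "bfun \<Rightarrow> bool" where "poly2 f \<longleftrightarrow> (\<exists>m. plt m f)"

lemma plt_imp_poly2: "plt m f \<Longrightarrow> poly2 f"
  unfolding poly2_def by blast

lemma poly2_zero: "poly2 (\<lambda>x y. 0)"
  using plt_imp_poly2 plt_zero by blast

lemma poly2_monomial: "poly2 (\<lambda>x y. x ^ i * y ^ j)"
  using plt_imp_poly2 plt_monomial lessI by blast

lemma poly2_scale: "poly2 f \<Longrightarrow> poly2 (\<lambda>x y. k * f x y)"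
  unfolding poly2_def using plt_scale by blast

lemma poly2_add: "poly2 f \<Longrightarrow> poly2 g \<Longrightarrow> poly2 (\<lambda>x y. f x y + g x y)"
  unfolding poly2_def using plt_add plt_mono by (meson nle_le)

lemma poly2_diff: "poly2 f \<Longrightarrow> poly2 g \<Longrightarrow> poly2 (\<lambda>x y. f x y - g x y)"
  using poly2_add[of f "\<lambda>x y. (-1) * g x y"] poly2_scale[of g "-1"] by simp

lemma poly2_mult: "poly2 f \<Longrightarrow> poly2 g \<Longrightarrow> poly2 (\<lambda>x y. f x y * g x y)"
  unfolding poly2_def using plt_mult plt_mono by (meson le_SucI order_refl)

lemma poly2_const: "poly2 (\<lambda>x y. k)"
  using plt_imp_poly2 plt_const by blast

lemma poly2_x: "poly2 (\<lambda>x y. x)"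
  using plt_imp_poly2 plt_x by blast

lemma poly2_y: "poly2 (\<lambda>x y. y)"
  using plt_imp_poly2 plt_y by blast

lemma poly2_z: "poly2 (\<lambda>x y. 1 - x - y)"
  using plt_imp_poly2 plt_z by blast

lemmas poly2_intros = poly2_const poly2_x poly2_y poly2_add poly2_diff poly2_mult

text \<open>The cases \<open>add\<close> and \<open>scale\<close> also hand over
  \<open>poly2\<close>, because \<open>dx\<close>, \<open>dy\<close> and \<open>Lop\<close> are
  shown to be linear only on polynomials, where the derivatives exist.\<close>

lemma poly2_induct [consumes 1, case_names monomial zero add scale]:
  assumes "poly2 f"
    and mon: "\<And>i j. Q (\<lambda>x y. x ^ i * y ^ j)"
    and zero: "Q (\<lambda>x y. 0)"
    and add: "\<And>f g. poly2 f \<Longrightarrow> poly2 g \<Longrightarrow> Q f \<Longrightarrow> Q g \<Longrightarrow> Q (\<lambda>x y. f x y + g x y)"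
    and scale: "\<And>k f. poly2 f \<Longrightarrow> Q f \<Longrightarrow> Q (\<lambda>x y. k * f x y)"
  shows "Q f"
proof -
  from assms(1) obtain m where "plt m f" unfolding poly2_def by blast
  then have "poly2 f \<and> Q f"
    by (induction rule: plt_induct)
      (auto intro: poly2_zero poly2_monomial poly2_add poly2_scale mon zero add scale)
  then show ?thesis by simp
qed

text \<open>A nonzero polynomial has finitely many roots, whereas the interval is infinite. The
  bound 1/2 makes the square of the interval fit inside the triangle.\<close>

lemma coeffs_zero_on_interval:
  fixes c :: "nat \<Rightarrow> real"
  assumes "\<And>x. 0 < x \<Longrightarrow> x < 1 / 2 \<Longrightarrow> (\<Sum>i<n. c i * x ^ i) = 0" and "i < n"
  shows "c i = 0"
proof (rule ccontr)
  assume "c i \<noteq> 0"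
  have eq: "{..<n} = {..n - 1}" using assms(2) by (cases n) (auto simp: lessThan_Suc_atMost)
  have "finite {z. (\<Sum>i\<le>n - 1. c i * z ^ i) = 0}"
    using \<open>c i \<noteq> 0\<close> assms(2) by (subst polyfun_finite_roots) (auto intro!: exI[of _ i])
  moreover have "{0<..<1/2} \<subseteq> {z. (\<Sum>i\<le>n - 1. c i * z ^ i) = 0}"
    using assms(1) by (auto simp: eq)
  ultimately have "finite {0<..<1/2 :: real}" by (rule rev_finite_subset)
  then show False by (simp add: infinite_Ioo)
qed

text \<open>The one-variable case is applied twice: for fixed y the coefficients of the powers of x
  are themselves polynomials in y.\<close>

lemma plt_coeffs_zero:
  fixes c :: "nat \<Rightarrow> nat \<Rightarrow> real"
  assumes "\<And>x y. 0 < x \<Longrightarrow> x < 1 / 2 \<Longrightarrow> 0 < y \<Longrightarrow> y < 1 / 2 \<Longrightarrow>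
      (\<Sum>i<m. \<Sum>j<m - i. c i j * x ^ i * y ^ j) = 0" and "i + j < m"
  shows "c i j = 0"
proof (rule coeffs_zero_on_interval[where n = "m - i" and c = "c i"])
  fix y :: real assume y: "0 < y" "y < 1 / 2"
  show "(\<Sum>j<m - i. c i j * y ^ j) = 0"
  proof (rule coeffs_zero_on_interval[where n = m and c = "\<lambda>i. \<Sum>j<m - i. c i j * y ^ j"])
    fix x :: real assume x: "0 < x" "x < 1 / 2"
    have "(\<Sum>i<m. (\<Sum>j<m - i. c i j * y ^ j) * x ^ i) = (\<Sum>i<m. \<Sum>j<m - i. c i j * x ^ i * y ^ j)"
      unfolding sum_distrib_right by (intro sum.cong refl) simp
    then show "(\<Sum>i<m. (\<Sum>j<m - i. c i j * y ^ j) * x ^ i) = 0"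
      using assms(1)[OF x y] by simp
  qed (use assms in auto)
qed (use assms in auto)

text \<open>The box lies in the interior of \<open>T2\<close>, where the weight is positive, the
  Rodrigues formula is valid and the coordinate factors do not vanish. Identities established there
  extend to the plane.\<close>

lemma poly2_zero_on_box:
  assumes "poly2 f" and "\<And>x y. 0 < x \<Longrightarrow> x < 1 / 2 \<Longrightarrow> 0 < y \<Longrightarrow> y < 1 / 2 \<Longrightarrow> f x y = 0"
  shows "f = (\<lambda>x y. 0)"
proof -
  from assms(1) obtain m c where
    c: "\<forall>x y. f x y = (\<Sum>i<m. \<Sum>j<m - i. c i j * x ^ i * y ^ j)" unfolding poly2_def plt_def by blast
  have "c i j = 0" if "i + j < m" for i j
    by (rule plt_coeffs_zero[OF _ that]) (use assms(2) c in auto)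
  then have "f x y = 0" for x y
    unfolding c[rule_format] by (intro sum.neutral ballI) auto
  then show ?thesis by (auto simp: fun_eq_iff)
qed

lemma leading_coeffs_zero:
  assumes "plt m (\<lambda>x y. \<Sum>k\<le>m. d k * (x ^ (m - k) * y ^ k))" and "k \<le> m"
  shows "d k = 0"
proof -
  from assms(1) obtain c where
    c: "\<forall>x y. (\<Sum>k\<le>m. d k * (x ^ (m - k) * y ^ k)) = (\<Sum>i<m. \<Sum>j<m - i. c i j * x ^ i * y ^ j)"
    unfolding plt_def by blast
  \<comment> \<open>One coefficient array for the difference of the two expansions: \<open>d\<close>
    on the top antidiagonal, \<open>- c\<close> below it.\<close>
  define e where "e i j = (if i + j = m then d j else - c i j)" for i j
  have 1: "(\<Sum>k\<le>m. d k * (x ^ (m - k) * y ^ k)) = (\<Sum>i<Suc m. d (m - i) * x ^ i * y ^ (m - i))" for x y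
    unfolding lessThan_Suc_atMost by (rule sum.reindex_bij_witness[of _ "\<lambda>i. m - i" "\<lambda>i. m - i"]) auto
  have 2: "(\<Sum>i<m. \<Sum>j<m - i. c i j * x ^ i * y ^ j) = (\<Sum>i<Suc m. \<Sum>j<m - i. c i j * x ^ i * y ^ j)" for x y
    by simp
  have "(\<Sum>i<Suc m. \<Sum>j<Suc m - i. e i j * x ^ i * y ^ j) =
    (\<Sum>i<Suc m. d (m - i) * x ^ i * y ^ (m - i) - (\<Sum>j<m - i. c i j * x ^ i * y ^ j))" for x y
  proof (rule sum.cong)
    fix i assume "i \<in> {..<Suc m}"
    then have s: "Suc m - i = Suc (m - i)" "i + (m - i) = m" by auto
    have "(\<Sum>j<m - i. e i j * x ^ i * y ^ j) = - (\<Sum>j<m - i. c i j * x ^ i * y ^ j)"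
      unfolding sum_negf[symmetric] by (rule sum.cong) (auto simp: e_def)
    then show "(\<Sum>j<Suc m - i. e i j * x ^ i * y ^ j) =
      d (m - i) * x ^ i * y ^ (m - i) - (\<Sum>j<m - i. c i j * x ^ i * y ^ j)"
      unfolding s(1) by (simp add: e_def s(2))
  qed simp
  then have "(\<Sum>i<Suc m. \<Sum>j<Suc m - i. e i j * x ^ i * y ^ j) = 0" for x y
    using trans[OF 1[of x y, symmetric] trans[OF c[rule_format, of x y] 2[of x y]]]
    by (simp only: sum_subtractf diff_self)
  then have "e (m - k) k = 0"
    by (rule plt_coeffs_zero[where m = "Suc m"]) (simp add: assms(2))
  then show ?thesis using assms(2) by (simp add: e_def)
qed

text \<open>The coefficients of the top form will be the coordinates of an eigenfunction in
  \<open>has_dim_Eig\<close>.\<close>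

lemma plt_Suc_leading:
  assumes "plt (Suc m) f"
  shows "\<exists>d g. plt m g \<and> (\<forall>x y. f x y = (\<Sum>k\<le>m. d k * (x ^ (m - k) * y ^ k)) + g x y)"
  using assms
proof (induction rule: plt_induct)
  case (monomial i j)
  show ?case
  proof (cases "i + j = m")
    case True
    have "x ^ i * y ^ j = (\<Sum>k\<le>m. (if k = j then 1 else 0) * (x ^ (m - k) * y ^ k))" for x y :: real
    proof -
      have "(\<Sum>k\<le>m. (if k = j then 1 else 0) * (x ^ (m - k) * y ^ k)) =
        (\<Sum>k\<le>m. if k = j then x ^ (m - j) * y ^ j else 0)" by (rule sum.cong) auto
      with True show ?thesis by auto
    qed
    then show ?thesis
      by (intro exI[of _ "\<lambda>k. if k = j then 1 else 0"] exI[of _ "\<lambda>x y. 0"]) (auto simp: plt_zero)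
  next
    case False
    then have "plt m (\<lambda>x y. x ^ i * y ^ j)" using monomial by (intro plt_monomial) auto
    then show ?thesis
      by (intro exI[of _ "\<lambda>k. 0"] exI[of _ "\<lambda>x y. x ^ i * y ^ j"]) auto
  qed
next
  case zero
  show ?case by (intro exI[of _ "\<lambda>k. 0"] exI[of _ "\<lambda>x y. 0"]) (auto simp: plt_zero)
next
  case (add f1 f2)
  then obtain d1 g1 d2 g2 where
    "plt m g1" "\<forall>x y. f1 x y = (\<Sum>k\<le>m. d1 k * (x ^ (m - k) * y ^ k)) + g1 x y"
    "plt m g2" "\<forall>x y. f2 x y = (\<Sum>k\<le>m. d2 k * (x ^ (m - k) * y ^ k)) + g2 x y" by blast
  then show ?case
    by (intro exI[of _ "\<lambda>k. d1 k + d2 k"] exI[of _ "\<lambda>x y. g1 x y + g2 x y"])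
      (auto simp: sum.distrib algebra_simps intro: plt_add)
next
  case (scale a f1)
  then obtain d1 g1 where
    "plt m g1" "\<forall>x y. f1 x y = (\<Sum>k\<le>m. d1 k * (x ^ (m - k) * y ^ k)) + g1 x y" by blast
  then show ?case
    by (intro exI[of _ "\<lambda>k. a * d1 k"] exI[of _ "\<lambda>x y. a * g1 x y"])
      (auto simp: sum_distrib_left algebra_simps intro: plt_scale)
qed


section \<open>The differential operator and its eigenspaces\<close>

lemma poly2_differentiable:
  assumes "poly2 f"
  shows "(\<lambda>s. f s y) field_differentiable (at x)" "(\<lambda>t. f x t) field_differentiable (at y)"
proof -
  have "(\<forall>x y. (\<lambda>s. f s y) field_differentiable (at x)) \<and> (\<forall>x y. (\<lambda>t. f x t) field_differentiable (at y))"
    using assms by (induction rule: poly2_induct) (auto intro!: derivative_intros field_differentiable_add field_differentiable_mult)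
  then show "(\<lambda>s. f s y) field_differentiable (at x)" "(\<lambda>t. f x t) field_differentiable (at y)"
    by blast+
qed

lemma poly2_DERIV_dx: "poly2 f \<Longrightarrow> ((\<lambda>s. f s y) has_real_derivative dx f x y) (at x)"
  unfolding dx_def by (rule DERIV_deriv_iff_field_differentiable[THEN iffD2]) (rule poly2_differentiable)

lemma poly2_DERIV_dy: "poly2 f \<Longrightarrow> ((\<lambda>t. f x t) has_real_derivative dy f x y) (at y)"
  unfolding dy_def by (rule DERIV_deriv_iff_field_differentiable[THEN iffD2]) (rule poly2_differentiable)

lemma dx_eqI: "(\<And>x y. ((\<lambda>s. f s y) has_real_derivative g x y) (at x)) \<Longrightarrow> dx f = g"
  unfolding dx_def by (intro ext) (rule DERIV_imp_deriv)

lemma dy_eqI: "(\<And>x y. ((\<lambda>t. f x t) has_real_derivative g x y) (at y)) \<Longrightarrow> dy f = g"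
  unfolding dy_def by (intro ext) (rule DERIV_imp_deriv)

lemma dx_monomial: "dx (\<lambda>x y. x ^ i * y ^ j) = (\<lambda>x y. real i * (x ^ (i - 1) * y ^ j))"
  by (rule dx_eqI) (auto intro!: derivative_eq_intros)

lemma dy_monomial: "dy (\<lambda>x y. x ^ i * y ^ j) = (\<lambda>x y. real j * (x ^ i * y ^ (j - 1)))"
  by (rule dy_eqI) (auto intro!: derivative_eq_intros)

lemma dx_const: "dx (\<lambda>x y. k) = (\<lambda>x y. 0)" and dy_const: "dy (\<lambda>x y. k) = (\<lambda>x y. 0)"
  by (rule dx_eqI dy_eqI, simp)+

lemma dx_add: "poly2 f \<Longrightarrow> poly2 g \<Longrightarrow> dx (\<lambda>x y. f x y + g x y) = (\<lambda>x y. dx f x y + dx g x y)"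
  by (rule dx_eqI) (intro derivative_intros poly2_DERIV_dx)

lemma dy_add: "poly2 f \<Longrightarrow> poly2 g \<Longrightarrow> dy (\<lambda>x y. f x y + g x y) = (\<lambda>x y. dy f x y + dy g x y)"
  by (rule dy_eqI) (intro derivative_intros poly2_DERIV_dy)

lemma dx_diff: "poly2 f \<Longrightarrow> poly2 g \<Longrightarrow> dx (\<lambda>x y. f x y - g x y) = (\<lambda>x y. dx f x y - dx g x y)"
  by (rule dx_eqI) (intro derivative_intros poly2_DERIV_dx)

lemma dy_diff: "poly2 f \<Longrightarrow> poly2 g \<Longrightarrow> dy (\<lambda>x y. f x y - g x y) = (\<lambda>x y. dy f x y - dy g x y)"
  by (rule dy_eqI) (intro derivative_intros poly2_DERIV_dy)

lemma dx_scale: "poly2 f \<Longrightarrow> dx (\<lambda>x y. k * f x y) = (\<lambda>x y. k * dx f x y)"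
  by (rule dx_eqI) (auto intro!: derivative_eq_intros poly2_DERIV_dx)

lemma dy_scale: "poly2 f \<Longrightarrow> dy (\<lambda>x y. k * f x y) = (\<lambda>x y. k * dy f x y)"
  by (rule dy_eqI) (auto intro!: derivative_eq_intros poly2_DERIV_dy)

lemma poly2_dx: "poly2 f \<Longrightarrow> poly2 (dx f)"
  by (induction rule: poly2_induct)
    (auto simp: dx_monomial dx_const dx_add dx_scale poly2_zero intro: poly2_add poly2_scale poly2_monomial)

lemma poly2_dy: "poly2 f \<Longrightarrow> poly2 (dy f)"
  by (induction rule: poly2_induct)
    (auto simp: dy_monomial dy_const dy_add dy_scale poly2_zero intro: poly2_add poly2_scale poly2_monomial)

lemma dx_dy_commute: "poly2 f \<Longrightarrow> dx (dy f) = dy (dx f)"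
  by (induction rule: poly2_induct)
    (simp_all add: dx_monomial dy_monomial dx_const dy_const dx_add dx_scale dy_add dy_scale
      poly2_dx poly2_dy poly2_monomial mult.left_commute)

lemma Lop_zero: "Lop a b c (\<lambda>x y. 0) = (\<lambda>x y. 0)"
  by (simp add: fun_eq_iff Lop_def dx_const dy_const)

lemma Lop_add:
  "poly2 f \<Longrightarrow> poly2 g \<Longrightarrow> Lop a b c (\<lambda>x y. f x y + g x y) = (\<lambda>x y. Lop a b c f x y + Lop a b c g x y)"
  by (simp add: fun_eq_iff Lop_def dx_add dy_add poly2_dx poly2_dy algebra_simps)

lemma Lop_diff:
  "poly2 f \<Longrightarrow> poly2 g \<Longrightarrow> Lop a b c (\<lambda>x y. f x y - g x y) = (\<lambda>x y. Lop a b c f x y - Lop a b c g x y)"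
  by (simp add: fun_eq_iff Lop_def dx_diff dy_diff poly2_dx poly2_dy algebra_simps)

lemma Lop_scale: "poly2 f \<Longrightarrow> Lop a b c (\<lambda>x y. k * f x y) = (\<lambda>x y. k * Lop a b c f x y)"
  by (simp add: fun_eq_iff Lop_def dx_scale dy_scale poly2_dx poly2_dy algebra_simps)

lemma poly2_Lop:
  assumes "poly2 f"
  shows "poly2 (Lop a b c f)"
proof -
  have "Lop a b c f = (\<lambda>x y. x * (1 - x) * dx (dx f) x y - 2 * x * y * dy (dx f) x y + y * (1 - y) * dy (dy f) x y
     + (a + 1 - (a + b + c + 3) * x) * dx f x y + (b + 1 - (a + b + c + 3) * y) * dy f x y)"
    by (simp add: Lop_def fun_eq_iff)
  then show ?thesis using assms by (simp add: poly2_intros poly2_dx poly2_dy)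
qed

definition eigval :: "real \<Rightarrow> real \<Rightarrow> real \<Rightarrow> nat \<Rightarrow> real" where
  "eigval a b c n = real n * (real n + a + b + c + 2)"

lemma Lop_monomial:
  "Lop a b c (\<lambda>x y. x ^ i * y ^ j) = (\<lambda>x y. - eigval a b c (i + j) * (x ^ i * y ^ j)
     + real i * (real i + a) * (x ^ (i - 1) * y ^ j) + real j * (real j + b) * (x ^ i * y ^ (j - 1)))"
proof (intro ext)
  fix x y :: real
  \<comment> \<open>The truncated exponents i - 1 and i - 2 are harmless: the factors i and i - 1
    vanish exactly where truncation changes the power.\<close>
  have xx: "x * (real i * (real (i - 1) * x ^ (i - 1 - 1))) = real i * (real i - 1) * x ^ (i - 1)"
    "x * (real i * x ^ (i - 1)) = real i * x ^ i" for x :: real and i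
    by (cases i; cases "i - 1"; simp)+
  have "Lop a b c (\<lambda>x y. x ^ i * y ^ j) x y =
      (x * (real i * (real (i - 1) * x ^ (i - 1 - 1)))) * y ^ j
      - x * (x * (real i * (real (i - 1) * x ^ (i - 1 - 1)))) * y ^ j
      - 2 * (x * (real i * x ^ (i - 1))) * (y * (real j * y ^ (j - 1)))
      + x ^ i * (y * (real j * (real (j - 1) * y ^ (j - 1 - 1))))
      - x ^ i * (y * (y * (real j * (real (j - 1) * y ^ (j - 1 - 1)))))
      + (a + 1) * real i * x ^ (i - 1) * y ^ j - (a + b + c + 3) * (x * (real i * x ^ (i - 1))) * y ^ j
      + (b + 1) * real j * x ^ i * y ^ (j - 1) - (a + b + c + 3) * x ^ i * (y * (real j * y ^ (j - 1)))"
    by (simp add: Lop_def dx_monomial dy_monomial dx_scale dy_scale poly2_monomial) (simp add: algebra_simps)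
  also have "\<dots> = - eigval a b c (i + j) * (x ^ i * y ^ j)
     + real i * (real i + a) * (x ^ (i - 1) * y ^ j) + real j * (real j + b) * (x ^ i * y ^ (j - 1))"
  proof -
    have e: "x * (real i * (real i - 1) * x ^ (i - 1)) = (real i - 1) * (x * (real i * x ^ (i - 1)))"
      "y * (real j * (real j - 1) * y ^ (j - 1)) = (real j - 1) * (y * (real j * y ^ (j - 1)))"
      by (simp_all only: mult_ac)
    show ?thesis
      unfolding xx(1) e unfolding xx(2) eigval_def by (simp add: algebra_simps)
  qed
  finally show "Lop a b c (\<lambda>x y. x ^ i * y ^ j) x y = \<dots>" .
qed

text \<open>On forms of degree m the diagonal part of \<open>Lop\<close> is the scalar
  \<open>- eigval a b c m\<close>, so the added multiple cancels the top form.\<close>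

lemma plt_Lop_eigval:
  assumes "plt (Suc m) f"
  shows "plt m (\<lambda>x y. Lop a b c f x y + eigval a b c m * f x y)"
proof -
  from assms have "poly2 f \<and> plt m (\<lambda>x y. Lop a b c f x y + eigval a b c m * f x y)"
  proof (induction rule: plt_induct)
    case (monomial i j)
    have 1: "plt m (\<lambda>x y. real i * (real i + a) * (x ^ (i - 1) * y ^ j))"
    proof (cases "i = 0")
      case False
      with monomial show ?thesis by (intro plt_scale plt_monomial) simp
    qed (simp add: plt_zero)
    have 2: "plt m (\<lambda>x y. real j * (real j + b) * (x ^ i * y ^ (j - 1)))"
    proof (cases "j = 0")
      case False
      with monomial show ?thesis by (intro plt_scale plt_monomial) simp
    qed (simp add: plt_zero)
    have 3: "plt m (\<lambda>x y. (eigval a b c m - eigval a b c (i + j)) * (x ^ i * y ^ j))"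
    proof (cases "i + j = m")
      case False
      with monomial show ?thesis by (intro plt_scale plt_monomial) simp
    qed (simp add: plt_zero)
    show ?case using plt_add[OF 3 plt_add[OF 1 2]]
      by (simp add: Lop_monomial poly2_monomial algebra_simps)
  next
    case (add f g)
    then show ?case
      using plt_add[of m "\<lambda>x y. Lop a b c f x y + eigval a b c m * f x y" "\<lambda>x y. Lop a b c g x y + eigval a b c m * g x y"]
      by (simp add: Lop_add poly2_add algebra_simps)
  next
    case (scale k f)
    then show ?case
      using plt_scale[of m "\<lambda>x y. Lop a b c f x y + eigval a b c m * f x y" k]
      by (simp add: Lop_scale poly2_scale algebra_simps)
  qed (simp add: Lop_zero poly2_zero plt_zero)
  then show ?thesis by simp
qed

section \<open>Eigenspaces: vanishing in low degree, solvability, dimension\<close>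

definition Eig :: "real \<Rightarrow> real \<Rightarrow> real \<Rightarrow> nat \<Rightarrow> bfun set" where
  "Eig a b c n = {f. plt (Suc n) f \<and> Lop a b c f = (\<lambda>x y. - eigval a b c n * f x y)}"

lemma EigI: "plt (Suc n) f \<Longrightarrow> (\<And>x y. Lop a b c f x y = - eigval a b c n * f x y) \<Longrightarrow> f \<in> Eig a b c n"
  unfolding Eig_def by (auto simp: fun_eq_iff)

lemma EigD:
  assumes "f \<in> Eig a b c n"
  shows "plt (Suc n) f" "poly2 f" "Lop a b c f x y = - eigval a b c n * f x y"
  using assms unfolding Eig_def by (auto simp: fun_eq_iff poly2_def)

lemma Eig_zero: "(\<lambda>x y. 0) \<in> Eig a b c n"
  by (auto intro!: EigI simp: plt_zero Lop_zero)

lemma Eig_add: "f \<in> Eig a b c n \<Longrightarrow> g \<in> Eig a b c n \<Longrightarrow> (\<lambda>x y. f x y + g x y) \<in> Eig a b c n"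
  by (intro EigI) (simp_all add: EigD(1) plt_add Lop_add EigD algebra_simps)

lemma Eig_scale: "f \<in> Eig a b c n \<Longrightarrow> (\<lambda>x y. k * f x y) \<in> Eig a b c n"
  by (intro EigI) (simp_all add: EigD(1) plt_scale Lop_scale EigD algebra_simps)

lemma Eig_sum:
  "finite S \<Longrightarrow> (\<And>s. s \<in> S \<Longrightarrow> F s \<in> Eig a b c n) \<Longrightarrow> (\<lambda>x y. \<Sum>s\<in>S. F s x y) \<in> Eig a b c n"
  by (induction S rule: finite_induct) (auto simp: Eig_zero intro: Eig_add)

text \<open>On an eigenfunction the degree-lowering operator of \<open>plt_Lop_eigval\<close> is
  multiplication by the nonzero number \<open>d\<close>; hence the function itself loses one degree
  at a time, down to the zero space \<open>plt 0\<close>.\<close>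

lemma Eig_lower_degree_zero:
  assumes "f \<in> Eig a b c n" "plt m f" "\<And>k. k < m \<Longrightarrow> eigval a b c k \<noteq> eigval a b c n"
  shows "f = (\<lambda>x y. 0)"
  using assms(2,3)
proof (induction m)
  case 0
  then show ?case by (simp add: plt_0)
next
  case (Suc m)
  define d where "d = eigval a b c m - eigval a b c n"
  have d: "d \<noteq> 0" using Suc.prems(2)[of m] by (simp add: d_def)
  have "plt m (\<lambda>x y. (1 / d) * (Lop a b c f x y + eigval a b c m * f x y))"
    by (intro plt_scale plt_Lop_eigval Suc.prems)
  also have "(\<lambda>x y. (1 / d) * (Lop a b c f x y + eigval a b c m * f x y)) = f"
    using d by (auto simp: fun_eq_iff EigD(3)[OF assms(1)] field_simps d_def)
  finally show ?case using Suc by auto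
qed

text \<open>Back substitution in a triangular system: g / d solves the equation up to an error of
  lower degree, which the induction hypothesis removes.\<close>

lemma Lop_eigval_surj:
  assumes "plt m g" "\<And>k. k < m \<Longrightarrow> eigval a b c k \<noteq> eigval a b c n"
  shows "\<exists>h. plt m h \<and> (\<forall>x y. Lop a b c h x y + eigval a b c n * h x y = g x y)"
  using assms
proof (induction m arbitrary: g)
  case 0
  then show ?case by (intro exI[of _ "\<lambda>x y. 0"]) (simp add: plt_0 Lop_zero)
next
  case (Suc m)
  define d where "d = eigval a b c n - eigval a b c m"
  have d: "d \<noteq> 0" using Suc.prems(2)[of m] by (simp add: d_def)
  have pg: "poly2 g" using Suc.prems(1) by (rule plt_imp_poly2)
  \<comment> \<open>The operator maps g / d to g - r, so the correction \<open>h\<close> has to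
    produce \<open>r\<close>.\<close>
  define r where "r = (\<lambda>x y. (- (1 / d)) * (Lop a b c g x y + eigval a b c m * g x y))"
  have "plt m r" unfolding r_def by (intro plt_scale plt_Lop_eigval Suc.prems)
  with Suc obtain h where h: "plt m h" "\<And>x y. Lop a b c h x y + eigval a b c n * h x y = r x y"
    by (metis less_SucI)
  have ph: "poly2 h" using h(1) by (rule plt_imp_poly2)
  show ?case
  proof (intro exI[of _ "\<lambda>x y. h x y + (1 / d) * g x y"] conjI allI)
    show "plt (Suc m) (\<lambda>x y. h x y + (1 / d) * g x y)"
      using h(1) Suc.prems(1) by (intro plt_add plt_scale) (auto intro: plt_mono)
    fix x y
    have "Lop a b c (\<lambda>x y. h x y + (1 / d) * g x y) x y + eigval a b c n * (h x y + (1 / d) * g x y)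
      = r x y + (1 / d) * (Lop a b c g x y + eigval a b c n * g x y)"
      unfolding h(2)[symmetric] Lop_add[OF ph poly2_scale[OF pg]] Lop_scale[OF pg] by (simp add: algebra_simps)
    also have "\<dots> = (1 / d) * d * g x y"
    proof -
      have "eigval a b c n = d + eigval a b c m" by (simp add: d_def)
      with d show ?thesis unfolding r_def by (simp add: field_simps)
    qed
    finally show "Lop a b c (\<lambda>x y. h x y + (1 / d) * g x y) x y + eigval a b c n * (h x y + (1 / d) * g x y) = g x y"
      using d by simp
  qed
qed

lemma eigval_neq:
  assumes "k < n" "real k + real n + a + b + c + 2 \<noteq> 0"
  shows "eigval a b c k \<noteq> eigval a b c n"
proof -
  have "eigval a b c n - eigval a b c k = (real n - real k) * (real k + real n + a + b + c + 2)"
    unfolding eigval_def by (simp add: algebra_simps)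
  with assms show ?thesis by auto
qed

text \<open>Each monomial of degree n can be corrected by lower terms to an eigenfunction. The
  leading coefficients then serve as coordinates, since an eigenfunction with zero top form is
  zero.\<close>

lemma has_dim_Eig:
  assumes ne: "\<And>k. k < n \<Longrightarrow> eigval a b c k \<noteq> eigval a b c n"
  shows "has_dim (Eig a b c n) (Suc n)"
proof -
  define L where "L f x y = Lop a b c f x y + eigval a b c n * f x y" for f x y
  have "\<exists>h. plt n h \<and> (\<lambda>x y. x ^ (n - k) * y ^ k - h x y) \<in> Eig a b c n" if "k \<le> n" for k
  proof -
    have p: "plt (Suc n) (\<lambda>x y. x ^ (n - k) * y ^ k)" using that by (intro plt_monomial) simp
    \<comment> \<open>Applied to the monomial, the operator gives a polynomial of degree below n;
      \<open>h\<close> is a preimage of it of degree below n, so the difference is in the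
      kernel.\<close>
    obtain h where h: "plt n h" "\<And>x y. Lop a b c h x y + eigval a b c n * h x y =
        Lop a b c (\<lambda>x y. x ^ (n - k) * y ^ k) x y + eigval a b c n * (x ^ (n - k) * y ^ k)"
      using Lop_eigval_surj[OF plt_Lop_eigval[OF p] ne] by blast
    have "(\<lambda>x y. x ^ (n - k) * y ^ k - h x y) \<in> Eig a b c n"
    proof (rule EigI)
      show "plt (Suc n) (\<lambda>x y. x ^ (n - k) * y ^ k - h x y)"
        using h(1) p by (intro plt_diff) (auto intro: plt_mono)
      show "Lop a b c (\<lambda>x y. x ^ (n - k) * y ^ k - h x y) x y = - eigval a b c n * (x ^ (n - k) * y ^ k - h x y)" for x y
        unfolding Lop_diff[OF poly2_monomial plt_imp_poly2[OF h(1)]] using h(2)[of x y] by (simp add: algebra_simps)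
    qed
    with h(1) show ?thesis by blast
  qed
  then have "\<forall>k\<in>{..n}. \<exists>h. plt n h \<and> (\<lambda>x y. x ^ (n - k) * y ^ k - h x y) \<in> Eig a b c n" by simp
  from bchoice[OF this] obtain h where h: "\<And>k. k \<le> n \<Longrightarrow> plt n (h k)"
    "\<And>k. k \<le> n \<Longrightarrow> (\<lambda>x y. x ^ (n - k) * y ^ k - h k x y) \<in> Eig a b c n" by auto
  define B where "B k x y = x ^ (n - k) * y ^ k - h k x y" for k and x y :: real
  define bs where "bs = map B [0..<Suc n]"
  have len: "length bs = Suc n" by (simp add: bs_def)
  have nth: "bs ! k = B k" if "k < Suc n" for k using that unfolding bs_def by (simp del: upt_Suc)
  have BE: "B k \<in> Eig a b c n" if "k < Suc n" for k using h(2)[of k] that unfolding B_def[abs_def] by simp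
  have lead: "(\<Sum>i<Suc n. d i * (bs ! i) x y) = (\<Sum>k\<le>n. d k * (x ^ (n - k) * y ^ k)) - (\<Sum>k\<le>n. d k * h k x y)"
    for d :: "nat \<Rightarrow> real" and x y
    unfolding sum_subtractf[symmetric] lessThan_Suc_atMost
    by (rule sum.cong) (auto simp: nth B_def algebra_simps)
  have hs: "plt n (\<lambda>x y. \<Sum>k\<le>n. d k * h k x y)" for d :: "nat \<Rightarrow> real"
    by (intro plt_sum plt_scale h) auto
  have cE: "(\<lambda>x y. \<Sum>i<Suc n. d i * (bs ! i) x y) \<in> Eig a b c n" for d :: "nat \<Rightarrow> real"
    by (intro Eig_sum Eig_scale) (auto simp: nth BE)
  show ?thesis unfolding has_dim_def
  proof (intro exI[of _ bs] conjI allI impI)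
    show "length bs = Suc n" by fact
    show "bs ! i \<in> Eig a b c n" if "i < Suc n" for i using that BE nth by simp
    show "cs ! i = 0" if *: "length cs = Suc n \<and> (\<forall>x y. (\<Sum>i<Suc n. cs ! i * (bs ! i) x y) = 0)" and "i < Suc n" for cs i
    proof (rule leading_coeffs_zero[of n "\<lambda>i. cs ! i"])
      have "(\<lambda>x y. \<Sum>k\<le>n. cs ! k * (x ^ (n - k) * y ^ k)) = (\<lambda>x y. \<Sum>k\<le>n. cs ! k * h k x y)"
      proof (intro ext)
        fix x y
        show "(\<Sum>k\<le>n. cs ! k * (x ^ (n - k) * y ^ k)) = (\<Sum>k\<le>n. cs ! k * h k x y)"
          using conjunct2[OF *, rule_format, of x y] lead[of "\<lambda>i. cs ! i" x y] by linarith
      qed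
      then show "plt n (\<lambda>x y. \<Sum>k\<le>n. cs ! k * (x ^ (n - k) * y ^ k))"
        by (rule ssubst[where P = "plt n"]) (rule hs)
    qed (use that in simp)
    show "Eig a b c n = {(\<lambda>x y. \<Sum>i<Suc n. cs ! i * (bs ! i) x y) |cs. length cs = Suc n}"
    proof (intro equalityI subsetI)
      fix f assume f: "f \<in> Eig a b c n"
      from plt_Suc_leading[OF EigD(1)[OF f]] obtain d g where d: "plt n g"
        "\<And>x y. f x y = (\<Sum>k\<le>n. d k * (x ^ (n - k) * y ^ k)) + g x y" by blast
      \<comment> \<open>The combination with the same leading coefficients is subtracted, leaving an
        eigenfunction of lower degree.\<close>
      have "(\<lambda>x y. f x y - (\<Sum>i<Suc n. d i * (bs ! i) x y)) = (\<lambda>x y. 0)"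
      proof (rule Eig_lower_degree_zero[OF _ _ ne])
        show "(\<lambda>x y. f x y - (\<Sum>i<Suc n. d i * (bs ! i) x y)) \<in> Eig a b c n"
          using Eig_add[OF f Eig_scale[OF cE[of d], of "-1"]] by (simp del: sum.lessThan_Suc)
        show "plt n (\<lambda>x y. f x y - (\<Sum>i<Suc n. d i * (bs ! i) x y))"
          unfolding d(2) lead using plt_add[OF d(1) hs[of d]] by simp
      qed simp
      then have "f = (\<lambda>x y. \<Sum>i<Suc n. d i * (bs ! i) x y)" by (simp add: fun_eq_iff del: sum.lessThan_Suc)
      also have "\<dots> = (\<lambda>x y. \<Sum>i<Suc n. map d [0..<Suc n] ! i * (bs ! i) x y)"
        by (intro ext sum.cong) (auto simp del: upt_Suc)
      finally show "f \<in> {(\<lambda>x y. \<Sum>i<Suc n. cs ! i * (bs ! i) x y) |cs. length cs = Suc n}"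
        by (intro CollectI exI[of _ "map d [0..<Suc n]"]) simp
    next
      fix f assume "f \<in> {(\<lambda>x y. \<Sum>i<Suc n. cs ! i * (bs ! i) x y) |cs. length cs = Suc n}"
      then show "f \<in> Eig a b c n" using cE by blast
    qed
  qed
qed


section \<open>Moments of the weight and orthogonality\<close>

text \<open>Euler's Beta integral after the substitution y = h t: the integrand contributes
  \<open>h powr (B + C)\<close> and the Jacobian one more factor h.\<close>

lemma nn_integral_Beta:
  fixes B C h :: real
  assumes "B > -1" "C > -1" "h > 0"
  shows "(\<integral>\<^sup>+y. ennreal (indicator {0..h} y * (y powr B * (h - y) powr C)) \<partial>lborel)
    = ennreal (h powr (B + C + 1) * Beta (B + 1) (C + 1))"
proof -
  have "((\<lambda>t. t powr ((B + 1) - 1) * (1 - t) powr ((C + 1) - 1)) has_integral Beta (B + 1) (C + 1)) {0..1}"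
    using assms by (intro has_integral_Beta_real) auto
  then have "((\<lambda>t. if t \<in> {0..1} then t powr B * (1 - t) powr C else 0) has_integral Beta (B + 1) (C + 1)) UNIV"
    by (simp only: has_integral_restrict_UNIV) simp
  moreover have "(\<lambda>t. if t \<in> {0..1} then t powr B * (1 - t) powr C else 0)
      = (\<lambda>t::real. indicator {0..1} t * (t powr B * (1 - t) powr C))"
    by (auto simp: fun_eq_iff)
  ultimately have 1: "(\<integral>\<^sup>+y. ennreal (indicator {0..1} y * (y powr B * (1 - y) powr C)) \<partial>lborel)
    = ennreal (Beta (B + 1) (C + 1))"
    by (intro nn_integral_has_integral_lborel) (auto intro!: mult_nonneg_nonneg)
  have "(\<integral>\<^sup>+y. ennreal (indicator {0..h} y * (y powr B * (h - y) powr C)) \<partial>lborel)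
    = \<bar>h\<bar> * (\<integral>\<^sup>+y. ennreal (indicator {0..h} (0 + h * y) * ((0 + h * y) powr B * (h - (0 + h * y)) powr C)) \<partial>lborel)"
    using assms by (intro nn_integral_real_affine) auto
  also have "(\<lambda>y. ennreal (indicator {0..h} (0 + h * y) * ((0 + h * y) powr B * (h - (0 + h * y)) powr C)))
    = (\<lambda>y. ennreal (h powr (B + C)) * ennreal (indicator {0..1} y * (y powr B * (1 - y) powr C)))"
  proof
    fix y
    have "h - h * y = h * (1 - y)" by (simp add: algebra_simps)
    then show "ennreal (indicator {0..h} (0 + h * y) * ((0 + h * y) powr B * (h - (0 + h * y)) powr C))
      = ennreal (h powr (B + C)) * ennreal (indicator {0..1} y * (y powr B * (1 - y) powr C))"
      using assms by (auto simp: indicator_def powr_mult powr_add zero_le_mult_iff ennreal_mult'[symmetric] mult_ac)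
  qed
  also have "\<bar>h\<bar> * (\<integral>\<^sup>+y. ennreal (h powr (B + C)) * ennreal (indicator {0..1} y * (y powr B * (1 - y) powr C)) \<partial>lborel)
     = ennreal (h powr (B + C + 1) * Beta (B + 1) (C + 1))"
  proof -
    have "(\<integral>\<^sup>+y. ennreal (h powr (B + C)) * ennreal (indicator {0..1} y * (y powr B * (1 - y) powr C)) \<partial>lborel)
      = ennreal (h powr (B + C)) * ennreal (Beta (B + 1) (C + 1))"
      unfolding 1[symmetric] by (rule nn_integral_cmult) measurable
    also have "\<dots> = ennreal (h powr (B + C) * Beta (B + 1) (C + 1))" by (simp add: ennreal_mult')
    also have "\<bar>h\<bar> * \<dots> = ennreal (h * (h powr (B + C) * Beta (B + 1) (C + 1)))"
      using assms by (simp add: ennreal_mult')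
    finally show ?thesis using assms by (simp add: powr_add mult_ac)
  qed
  finally show ?thesis .
qed

text \<open>The Dirichlet integral over the triangle as it arises by iteration: first over y in
  [0, 1 - x], then over x.\<close>

definition Dir :: "real \<Rightarrow> real \<Rightarrow> real \<Rightarrow> real" where
  "Dir A B C = Beta (B + 1) (C + 1) * Beta (A + 1) (B + C + 2)"

lemma Beta_real_nonneg: "x > 0 \<Longrightarrow> y > 0 \<Longrightarrow> Beta x y \<ge> (0::real)"
  unfolding Beta_def by (intro divide_nonneg_pos mult_nonneg_nonneg) (auto intro: Gamma_real_pos less_imp_le)

lemma T2_sets [measurable]: "T2 \<in> sets borel"
proof -
  have "T2 = {p. fst p \<ge> 0} \<inter> {p. snd p \<ge> 0} \<inter> {p. 1 - fst p - snd p \<ge> 0}"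
    unfolding T2_def by auto
  moreover have "closed \<dots>"
    by (intro closed_Int closed_Collect_le continuous_intros)
  ultimately show ?thesis by simp
qed

lemma has_bochner_integral_Dirichlet:
  assumes "A > -1" "B > -1" "C > -1"
  shows "has_bochner_integral lborel
    (\<lambda>p. indicator T2 p * (fst p powr A * snd p powr B * (1 - fst p - snd p) powr C)) (Dir A B C)"
proof (rule has_bochner_integral_nn_integral)
  let ?f = "\<lambda>p :: real \<times> real. indicator T2 p * (fst p powr A * snd p powr B * (1 - fst p - snd p) powr C)"
  have [measurable]: "fst \<in> borel_measurable (borel :: (real \<times> real) measure)"
    "snd \<in> borel_measurable (borel :: (real \<times> real) measure)"
    by (intro borel_measurable_continuous_onI continuous_intros)+
  show m: "?f \<in> borel_measurable lborel" by measurable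
  show "AE p in lborel. 0 \<le> ?f p" by (auto intro!: AE_I2)
  show "0 \<le> Dir A B C" unfolding Dir_def using assms by (intro mult_nonneg_nonneg Beta_real_nonneg) auto
  have m': "(\<lambda>p. ennreal (?f p)) \<in> borel_measurable (lborel \<Otimes>\<^sub>M lborel)"
    unfolding lborel_prod using m by measurable
  \<comment> \<open>At x = 1 the slice degenerates to a point and the Beta lemma would require h >
    0; this null set is left out.\<close>
  have inner: "(\<integral>\<^sup>+y. ennreal (?f (x, y)) \<partial>lborel)
      = ennreal (Beta (B + 1) (C + 1)) * ennreal (indicator {0..1} x * (x powr A * (1 - x) powr (B + C + 1)))"
    if "x \<noteq> 1" for x
  proof (cases "0 \<le> x \<and> x < 1")
    case True
    have "(\<integral>\<^sup>+y. ennreal (?f (x, y)) \<partial>lborel)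
      = (\<integral>\<^sup>+y. ennreal (x powr A) * ennreal (indicator {0..1 - x} y * (y powr B * ((1 - x) - y) powr C)) \<partial>lborel)"
      by (rule nn_integral_cong)
        (use True in \<open>auto simp: T2_def indicator_def ennreal_mult'[symmetric] mult_ac\<close>)
    also have "\<dots> = ennreal (x powr A) * ennreal ((1 - x) powr (B + C + 1) * Beta (B + 1) (C + 1))"
      using assms True by (subst nn_integral_cmult) (auto simp: nn_integral_Beta)
    finally show ?thesis
      using True assms by (simp add: ennreal_mult'[symmetric] ennreal_mult''[symmetric] Beta_real_nonneg mult_ac)
  next
    case False
    then have "(\<lambda>y. ennreal (?f (x, y))) = (\<lambda>y. 0)"
      using that by (auto simp: T2_def indicator_def fun_eq_iff)
    then have "(\<integral>\<^sup>+y. ennreal (?f (x, y)) \<partial>lborel) = 0" by simp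
    with False that show ?thesis by (auto simp: indicator_def)
  qed
  have "(\<integral>\<^sup>+p. ennreal (?f p) \<partial>lborel) = (\<integral>\<^sup>+x. \<integral>\<^sup>+y. ennreal (?f (x, y)) \<partial>lborel \<partial>lborel)"
    using lborel.nn_integral_fst[OF m'] unfolding lborel_prod by simp
  also have "\<dots> = (\<integral>\<^sup>+x. ennreal (Beta (B + 1) (C + 1)) * ennreal (indicator {0..1} x * (x powr A * (1 - x) powr (B + C + 1))) \<partial>lborel)"
    by (rule nn_integral_cong_AE, rule AE_mp[OF AE_lborel_singleton[of 1]], rule AE_I2, rule impI, erule inner)
  also have "\<dots> = ennreal (Dir A B C)"
    using assms nn_integral_Beta[of A "B + C + 1" 1]
    by (subst nn_integral_cmult) (auto simp: Dir_def ennreal_mult'' Beta_real_nonneg add_ac)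
  finally show "(\<integral>\<^sup>+p. ennreal (?f p) \<partial>lborel) = ennreal (Dir A B C)" .
qed

text \<open>The factor \<open>Gamma (B + C + 2)\<close> cancels, and the symmetry in the three
  exponents, hidden in the iterated form, appears.\<close>

lemma Dir_Gamma:
  assumes "A > -1" "B > -1" "C > -1"
  shows "Dir A B C = Gamma (A + 1) * Gamma (B + 1) * Gamma (C + 1) / Gamma (A + B + C + 3)"
proof -
  have "Gamma (B + C + 2) > 0" using assms by (intro Gamma_real_pos) auto
  moreover have "B + 1 + (C + 1) = B + C + 2" "A + 1 + (B + C + 2) = A + B + C + 3" by auto
  ultimately show ?thesis unfolding Dir_def Beta_def by (simp add: field_simps)
qed

lemma Gamma_plus1_real: "x > 0 \<Longrightarrow> Gamma (x + 1) = x * Gamma (x::real)"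
  by (rule Gamma_plus1) (auto elim!: nonpos_Ints_cases)

text \<open>This recurrence replaces integration by parts: together with its counterpart in the
  second exponent it is the relation between moments behind the symmetry of
  \<open>Lop\<close>.\<close>

lemma Dir_plus1_left:
  assumes "A > -1" "B > -1" "C > -1"
  shows "(A + B + C + 3) * Dir (A + 1) B C = (A + 1) * Dir A B C"
proof -
  have "Gamma (A + B + C + 3) > 0" using assms by (intro Gamma_real_pos) auto
  moreover have "Gamma (A + 1 + 1) = (A + 1) * Gamma (A + 1)"
    using assms by (intro Gamma_plus1_real) auto
  moreover have "Gamma (A + B + C + 3 + 1) = (A + B + C + 3) * Gamma (A + B + C + 3)"
    using assms by (intro Gamma_plus1_real) auto
  moreover have "A + 1 + B + C + 3 = A + B + C + 3 + 1" by simp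
  moreover have "A + B + C + 3 > 0" using assms by linarith
  ultimately show ?thesis using assms by (simp add: Dir_Gamma)
qed

lemma Dir_swap: "A > -1 \<Longrightarrow> B > -1 \<Longrightarrow> C > -1 \<Longrightarrow> Dir A B C = Dir B A C"
  by (simp add: Dir_Gamma add_ac mult_ac)

lemma Dir_plus1_right:
  assumes "A > -1" "B > -1" "C > -1"
  shows "(A + B + C + 3) * Dir A (B + 1) C = (B + 1) * Dir A B C"
  using Dir_plus1_left[of B A C] assms by (simp add: Dir_swap[of A] add_ac)

section \<open>Weighted integrals of polynomials\<close>

definition wint :: "real \<Rightarrow> real \<Rightarrow> real \<Rightarrow> bfun \<Rightarrow> real" where
  "wint a b c f = (LINT p:T2|lborel. W a b c (fst p) (snd p) * f (fst p) (snd p))"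

text \<open>At x = 0 both sides are 0 because \<open>0 powr a = 0\<close> for every exponent,
  including a = 0.\<close>

lemma powr_mult_power: "(x::real) \<ge> 0 \<Longrightarrow> x powr a * x ^ i = x powr (a + real i)"
  by (cases "x = 0") (auto simp: powr_add powr_realpow)

lemma has_bochner_integral_W_monomial:
  assumes "a > -1" "b > -1" "c > -1"
  shows "has_bochner_integral lborel (\<lambda>p. indicator T2 p *\<^sub>R (W a b c (fst p) (snd p) * (fst p ^ i * snd p ^ j)))
    (Dir (a + real i) (b + real j) c)"
proof -
  have "has_bochner_integral lborel
    (\<lambda>p. indicator T2 p * (fst p powr (a + real i) * snd p powr (b + real j) * (1 - fst p - snd p) powr c))
    (Dir (a + real i) (b + real j) c)"
    using assms by (intro has_bochner_integral_Dirichlet) auto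
  also have "(\<lambda>p. indicator T2 p * (fst p powr (a + real i) * snd p powr (b + real j) * (1 - fst p - snd p) powr c))
    = (\<lambda>p. indicator T2 p *\<^sub>R (W a b c (fst p) (snd p) * (fst p ^ i * snd p ^ j)))"
    by (auto simp: fun_eq_iff indicator_def T2_def W_def powr_mult_power[symmetric] mult_ac)
  finally show ?thesis .
qed

lemma wint_monomial:
  assumes "a > -1" "b > -1" "c > -1"
  shows "wint a b c (\<lambda>x y. x ^ i * y ^ j) = Dir (a + real i) (b + real j) c"
  using has_bochner_integral_integral_eq[OF has_bochner_integral_W_monomial[OF assms, of i j]]
  unfolding wint_def set_lebesgue_integral_def by simp

lemma set_integrable_W_poly2:
  assumes "a > -1" "b > -1" "c > -1" "poly2 f"
  shows "set_integrable lborel T2 (\<lambda>p. W a b c (fst p) (snd p) * f (fst p) (snd p))"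
  using assms(4)
proof (induction rule: poly2_induct)
  case (monomial i j)
  then show ?case
    using has_bochner_integral_W_monomial[OF assms(1-3), of i j]
    unfolding set_integrable_def by (simp add: has_bochner_integral_iff)
next
  case (add f g)
  then show ?case using set_integral_add(1) by (simp add: distrib_left)
next
  case (scale k f)
  then have "set_integrable lborel T2 (\<lambda>p. k * (W a b c (fst p) (snd p) * f (fst p) (snd p)))" by simp
  then show ?case by (simp add: mult_ac)
qed (simp add: set_integrable_def)

lemma wint_add:
  assumes "a > -1" "b > -1" "c > -1" "poly2 f" "poly2 g"
  shows "wint a b c (\<lambda>x y. f x y + g x y) = wint a b c f + wint a b c g"
  unfolding wint_def distrib_left using assms by (intro set_integral_add set_integrable_W_poly2)

lemma wint_scale: "wint a b c (\<lambda>x y. k * f x y) = k * wint a b c f"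
  unfolding wint_def by (simp add: mult.left_commute[of _ k])

lemma wint_mult_scale: "wint a b c (\<lambda>x y. f x y * (k * g x y)) = k * wint a b c (\<lambda>x y. f x y * g x y)"
  unfolding mult.left_commute[of _ k] by (rule wint_scale)

lemma wint_zero: "wint a b c (\<lambda>x y. 0) = 0"
  unfolding wint_def by (simp add: set_lebesgue_integral_def)

text \<open>A nonnegative integrand with integral 0 vanishes almost everywhere. The weight is
  positive on the open box, so \<open>f\<close> vanishes there almost everywhere, and everywhere
  because its zero set is closed.\<close>

lemma wint_square_zero:
  assumes abc: "a > -1" "b > -1" "c > -1" and f: "poly2 f" and z: "wint a b c (\<lambda>x y. f x y * f x y) = 0"
  shows "f = (\<lambda>x y. 0)"
proof (rule poly2_zero_on_box[OF f])
  let ?F = "\<lambda>p. indicator T2 p *\<^sub>R (W a b c (fst p) (snd p) * (f (fst p) (snd p) * f (fst p) (snd p)))"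
  have "integrable lborel ?F"
    using set_integrable_W_poly2[OF abc poly2_mult[OF f f]] unfolding set_integrable_def .
  moreover have "AE p in lborel. 0 \<le> ?F p"
    by (auto intro!: AE_I2 mult_nonneg_nonneg simp: W_def)
  ultimately have "AE p in lborel. ?F p = 0"
    using z integral_nonneg_eq_0_iff_AE unfolding wint_def set_lebesgue_integral_def by blast
  then have ae: "AE p in lebesgue. ?F p = 0" by (rule AE_completion)
  define S where "S = {0<..<1/2 :: real} \<times> {0<..<1/2 :: real}"
  define Z where "Z = {p. (\<lambda>p. f (fst p) (snd p)) p = 0}"
  have cont: "continuous_on UNIV (\<lambda>p. f (fst p) (snd p))"
    using f by (induction rule: poly2_induct) (auto intro!: continuous_intros)
  have "AE p \<in> S in lebesgue. p \<in> Z"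
    using ae
  proof eventually_elim
    case (elim p)
    then show ?case by (auto simp: S_def Z_def indicator_def T2_def W_def split: if_splits)
  qed
  note ae' = this
  have "p \<in> Z" if "p \<in> S" for p
  proof (rule mem_closed_if_AE_lebesgue_open[of S])
    show "open S" unfolding S_def by (intro open_Times) auto
    show "closed Z" unfolding Z_def by (intro closed_Collect_eq cont continuous_on_const)
  qed (use that ae' in auto)
  then show "f x y = 0" if "0 < x" "x < 1 / 2" "0 < y" "y < 1 / 2" for x y
    using that by (auto simp: S_def Z_def)
qed

text \<open>Both sides are combinations of moments. By the recurrences the lowering terms in x
  differ by (i - k) s M and those in y by (j - l) s M, where M is the moment of the product; the sum
  is exactly the contribution of the two eigenvalues.\<close>

lemma wint_Lop_symmetric_monomial:
  assumes abc: "a > -1" "b > -1" "c > -1"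
  shows "wint a b c (\<lambda>x y. Lop a b c (\<lambda>x y. x ^ i * y ^ j) x y * (x ^ k * y ^ l))
       = wint a b c (\<lambda>x y. (x ^ i * y ^ j) * Lop a b c (\<lambda>x y. x ^ k * y ^ l) x y)"
proof -
  define M where "M p q = Dir (a + real p) (b + real q) c" for p q
  \<comment> \<open>The same number is the factor in both moment recurrences and the second factor
    in the difference of the eigenvalues.\<close>
  define s where "s = real (i + k) + real (j + l) + a + b + c + 2"
  have w: "wint a b c (\<lambda>x y. A * (x ^ p * y ^ q) + B * (x ^ p' * y ^ q') + C * (x ^ p'' * y ^ q''))
    = A * M p q + B * M p' q' + C * M p'' q''" for A B C p q p' q' p'' q''
    using abc by (simp add: wint_add wint_scale wint_monomial poly2_add poly2_scale poly2_monomial M_def)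
  have L: "wint a b c (\<lambda>x y. Lop a b c (\<lambda>x y. x ^ i * y ^ j) x y * (x ^ k * y ^ l)) =
     - eigval a b c (i + j) * M (i + k) (j + l)
     + real i * (real i + a) * M (i - 1 + k) (j + l) + real j * (real j + b) * M (i + k) (j - 1 + l)" for i j k l
    unfolding w[symmetric] Lop_monomial by (simp add: power_add algebra_simps)
  have R: "wint a b c (\<lambda>x y. (x ^ i * y ^ j) * Lop a b c (\<lambda>x y. x ^ k * y ^ l) x y) =
     - eigval a b c (k + l) * M (i + k) (j + l)
     + real k * (real k + a) * M (k - 1 + i) (j + l) + real l * (real l + b) * M (i + k) (l - 1 + j)"
  proof -
    have "wint a b c (\<lambda>x y. (x ^ i * y ^ j) * Lop a b c (\<lambda>x y. x ^ k * y ^ l) x y)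
      = wint a b c (\<lambda>x y. Lop a b c (\<lambda>x y. x ^ k * y ^ l) x y * (x ^ i * y ^ j))"
      by (rule arg_cong[where f = "wint a b c"]) (rule ext, rule ext, rule mult.commute)
    then show ?thesis
      unfolding L[of k l i j] by (simp only: add.commute[of k i] add.commute[of l j])
  qed
  have X: "real i * (real i + a) * M (i - 1 + k) (j + l) - real k * (real k + a) * M (k - 1 + i) (j + l)
    = (real i - real k) * s * M (i + k) (j + l)"
  proof (cases "i + k")
    case (Suc r)
    have "(a + real r + (b + real (j + l)) + c + 3) * Dir (a + real r + 1) (b + real (j + l)) c
        = (a + real r + 1) * Dir (a + real r) (b + real (j + l)) c"
      using abc by (intro Dir_plus1_left) auto
    then have *: "s * M (i + k) (j + l) = (real i + real k + a) * M r (j + l)"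
      using Suc unfolding M_def s_def by (simp add: add_ac flip: of_nat_add)
    \<comment> \<open>For i = 0 the truncated index is wrong, but the factor i is then zero; this is
      why i stays on both sides.\<close>
    have "real i * M (i - 1 + k) (j + l) = real i * M r (j + l)"
      using Suc by (cases i) auto
    moreover have "real k * M (k - 1 + i) (j + l) = real k * M r (j + l)"
      using Suc by (cases k) (auto simp: add.commute)
    moreover have "real i * (real i + a) * M (i - 1 + k) (j + l) - real k * (real k + a) * M (k - 1 + i) (j + l)
      = (real i + a) * (real i * M (i - 1 + k) (j + l)) - (real k + a) * (real k * M (k - 1 + i) (j + l))"
      by (simp only: mult_ac)
    ultimately have "real i * (real i + a) * M (i - 1 + k) (j + l) - real k * (real k + a) * M (k - 1 + i) (j + l)
      = (real i + a) * (real i * M r (j + l)) - (real k + a) * (real k * M r (j + l))"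
      by (simp only:)
    also have "\<dots> = (real i - real k) * ((real i + real k + a) * M r (j + l))" by (simp add: algebra_simps)
    finally show ?thesis unfolding *[symmetric] by simp
  qed simp
  have Y: "real j * (real j + b) * M (i + k) (j - 1 + l) - real l * (real l + b) * M (i + k) (l - 1 + j)
    = (real j - real l) * s * M (i + k) (j + l)"
  proof (cases "j + l")
    case (Suc r)
    have "(a + real (i + k) + (b + real r) + c + 3) * Dir (a + real (i + k)) (b + real r + 1) c
        = (b + real r + 1) * Dir (a + real (i + k)) (b + real r) c"
      using abc by (intro Dir_plus1_right) auto
    then have *: "s * M (i + k) (j + l) = (real j + real l + b) * M (i + k) r"
      using Suc unfolding M_def s_def by (simp add: add_ac flip: of_nat_add)
    have "real j * M (i + k) (j - 1 + l) = real j * M (i + k) r"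
      using Suc by (cases j) auto
    moreover have "real l * M (i + k) (l - 1 + j) = real l * M (i + k) r"
      using Suc by (cases l) (auto simp: add.commute)
    moreover have "real j * (real j + b) * M (i + k) (j - 1 + l) - real l * (real l + b) * M (i + k) (l - 1 + j)
      = (real j + b) * (real j * M (i + k) (j - 1 + l)) - (real l + b) * (real l * M (i + k) (l - 1 + j))"
      by (simp only: mult_ac)
    ultimately have "real j * (real j + b) * M (i + k) (j - 1 + l) - real l * (real l + b) * M (i + k) (l - 1 + j)
      = (real j + b) * (real j * M (i + k) r) - (real l + b) * (real l * M (i + k) r)"
      by (simp only:)
    also have "\<dots> = (real j - real l) * ((real j + real l + b) * M (i + k) r)" by (simp add: algebra_simps)
    finally show ?thesis unfolding *[symmetric] by simp
  qed simp
  have "eigval a b c (i + j) - eigval a b c (k + l) = ((real i - real k) + (real j - real l)) * s"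
    unfolding eigval_def s_def by (simp add: algebra_simps)
  then have "(eigval a b c (i + j) - eigval a b c (k + l)) * M (i + k) (j + l) =
    (real i - real k) * s * M (i + k) (j + l) + (real j - real l) * s * M (i + k) (j + l)"
    by (simp only: distrib_right)
  then have "eigval a b c (i + j) * M (i + k) (j + l) - eigval a b c (k + l) * M (i + k) (j + l) =
    (real i - real k) * s * M (i + k) (j + l) + (real j - real l) * s * M (i + k) (j + l)"
    by (simp only: left_diff_distrib)
  with X Y show ?thesis unfolding L R by linarith
qed

lemma wint_Lop_symmetric:
  assumes abc: "a > -1" "b > -1" "c > -1" and f: "poly2 f" and g: "poly2 g"
  shows "wint a b c (\<lambda>x y. Lop a b c f x y * g x y) = wint a b c (\<lambda>x y. f x y * Lop a b c g x y)"
  using f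
proof (induction rule: poly2_induct)
  case (monomial i j)
  show ?case using g
  proof (induction rule: poly2_induct)
    case (monomial k l)
    show ?case using abc by (rule wint_Lop_symmetric_monomial)
  next
    case (add f g)
    then show ?case using abc
      by (simp add: Lop_add wint_add distrib_left poly2_mult poly2_monomial poly2_Lop)
  next
    case (scale k f)
    then show ?case using abc
      by (simp add: Lop_scale wint_scale mult.left_commute[of _ k])
  qed (simp add: Lop_zero)
next
  case (add f f')
  then show ?case using abc g
    by (simp add: Lop_add wint_add distrib_right poly2_mult poly2_Lop)
next
  case (scale k f)
  then show ?case using abc by (simp add: Lop_scale wint_scale mult.assoc)
qed (simp add: Lop_zero)

lemma eigval_neq_of_gt:
  assumes "a > -1" "b > -1" "c > -1" "k < n"
  shows "eigval a b c k \<noteq> eigval a b c n"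
  using assms by (intro eigval_neq) auto

text \<open>Polynomials of lower degree reduce, through \<open>Lop + eigval\<close>, to polynomials of still lower
  degree, so self-adjointness of \<open>Lop\<close> forces orthogonality.\<close>

lemma Eig_orthogonal:
  assumes abc: "a > -1" "b > -1" "c > -1" and f: "f \<in> Eig a b c n"
    and "plt m g" "m \<le> n"
  shows "wint a b c (\<lambda>x y. f x y * g x y) = 0"
  using assms(5,6)
proof (induction m arbitrary: g)
  case 0
  then show ?case by (simp add: plt_0 wint_zero)
next
  case (Suc m)
  have pf: "poly2 f" and pg: "poly2 g" using f Suc.prems by (auto intro: EigD plt_imp_poly2)
  have "0 = wint a b c (\<lambda>x y. f x y * (Lop a b c g x y + eigval a b c m * g x y))"
    using Suc.IH[OF plt_Lop_eigval[OF Suc.prems(1)]] Suc.prems by simp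
  also have "\<dots> = wint a b c (\<lambda>x y. f x y * Lop a b c g x y) + eigval a b c m * wint a b c (\<lambda>x y. f x y * g x y)"
    using abc pf pg by (simp add: distrib_left wint_add wint_mult_scale poly2_mult poly2_Lop poly2_scale)
  also have "wint a b c (\<lambda>x y. f x y * Lop a b c g x y) = wint a b c (\<lambda>x y. - eigval a b c n * (f x y * g x y))"
    unfolding wint_Lop_symmetric[OF abc pf pg, symmetric] EigD(3)[OF f] by (simp add: mult.assoc)
  also have "\<dots> = - eigval a b c n * wint a b c (\<lambda>x y. f x y * g x y)" by (rule wint_scale)
  finally have "(eigval a b c m - eigval a b c n) * wint a b c (\<lambda>x y. f x y * g x y) = 0"
    by (simp only: left_diff_distrib)
  then show ?case using eigval_neq_of_gt[OF abc, of m n] Suc.prems(2) by simp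
qed

text \<open>If \<open>f\<close> is orthogonal to lower degrees, g = (\<open>Lop\<close> +
  \<open>eigval\<close>) f has lower degree. By symmetry the integral of g^2 is that of f times
  (\<open>Lop\<close> + \<open>eigval\<close>) g, which is again of lower degree, so it is 0 and g =
  0.\<close>

lemma Vsp_eq_Eig:
  assumes abc: "a > -1" "b > -1" "c > -1"
  shows "Vsp (int n) a b c = Eig a b c n"
proof -
  have low: "(int n \<ge> 1 \<and> poly_le (nat (int n) - 1) g) \<longleftrightarrow> (plt n g \<and> n \<ge> 1)" for g
    by (cases n) (auto simp: poly_le_iff_plt simp del: of_nat_Suc)
  \<comment> \<open>For n = 0 the definition imposes no orthogonality condition;
    \<open>plt 0\<close> contains only the zero function, so one formula covers all n.\<close>
  have V: "f \<in> Vsp (int n) a b c \<longleftrightarrow> plt (Suc n) f \<and> (\<forall>g. plt n g \<longrightarrow> wint a b c (\<lambda>x y. f x y * g x y) = 0)" for f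
    unfolding Vsp_def low nat_int poly_le_iff_plt
    by (cases n) (auto simp: wint_def mult.assoc plt_0 set_lebesgue_integral_def)
  show ?thesis
  proof (intro equalityI subsetI)
    fix f assume "f \<in> Vsp (int n) a b c"
    then have f: "plt (Suc n) f" "\<And>g. plt n g \<Longrightarrow> wint a b c (\<lambda>x y. f x y * g x y) = 0"
      using V by auto
    have pf: "poly2 f" using f(1) by (rule plt_imp_poly2)
    define g where "g x y = Lop a b c f x y + eigval a b c n * f x y" for x y
    have g: "plt n g" unfolding g_def[abs_def] by (rule plt_Lop_eigval[OF f(1)])
    have pg: "poly2 g" using g by (rule plt_imp_poly2)
    have "wint a b c (\<lambda>x y. g x y * g x y)
      = wint a b c (\<lambda>x y. Lop a b c f x y * g x y + eigval a b c n * (f x y * g x y))"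
      by (rule arg_cong[where f = "wint a b c"]) (auto simp: g_def algebra_simps)
    also have "\<dots> = wint a b c (\<lambda>x y. Lop a b c f x y * g x y) + eigval a b c n * wint a b c (\<lambda>x y. f x y * g x y)"
      using abc pf pg by (simp add: wint_add wint_scale poly2_mult poly2_Lop poly2_scale)
    also have "\<dots> = wint a b c (\<lambda>x y. f x y * Lop a b c g x y) + eigval a b c n * wint a b c (\<lambda>x y. f x y * g x y)"
      unfolding wint_Lop_symmetric[OF abc pf pg] ..
    also have "\<dots> = wint a b c (\<lambda>x y. f x y * (Lop a b c g x y + eigval a b c n * g x y))"
      using abc pf pg by (simp add: distrib_left wint_add wint_mult_scale poly2_mult poly2_Lop poly2_scale)
    also have "\<dots> = 0"
    proof (rule f(2), cases n)
      case (Suc m)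
      have g': "plt (Suc m) g" using g Suc by simp
      \<comment> \<open>The eigenvalue of degree m is split off because
        \<open>plt_Lop_eigval\<close> applies to it; the rest is a multiple of
        \<open>g\<close>.\<close>
      have "plt (Suc m) (\<lambda>x y. (Lop a b c g x y + eigval a b c m * g x y) + (eigval a b c n - eigval a b c m) * g x y)"
        by (rule plt_add[OF plt_mono[OF plt_Lop_eigval[OF g']] plt_scale[OF g']]) simp
      then show "plt n (\<lambda>x y. Lop a b c g x y + eigval a b c n * g x y)"
        unfolding Suc by (simp add: algebra_simps)
    qed (use g in \<open>auto simp: plt_0 Lop_zero\<close>)
    finally have "g = (\<lambda>x y. 0)" using wint_square_zero[OF abc pg] by blast
    then show "f \<in> Eig a b c n"
      by (intro EigI f(1)) (auto simp: g_def fun_eq_iff eq_neg_iff_add_eq_0)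
  next
    fix f assume "f \<in> Eig a b c n"
    then show "f \<in> Vsp (int n) a b c"
      using V Eig_orthogonal[OF abc] EigD(1) by blast
  qed
qed

lemma Vsp_neg: "m < 0 \<Longrightarrow> Vsp m a b c = {\<lambda>x y. 0}"
  by (simp add: Vsp_def)


section \<open>Rodrigues polynomials\<close>

text \<open>Leibniz rule. The successive derivatives enter as sequences \<open>F\<close>,
  \<open>G\<close> valid on an open set, which suits real powers whose derivatives are known only
  for positive arguments.\<close>

lemma deriv_funpow_mult:
  fixes F G :: "nat \<Rightarrow> real \<Rightarrow> real"
  assumes S: "open S" and F: "\<And>k x. x \<in> S \<Longrightarrow> (F k has_real_derivative F (Suc k) x) (at x)"
    and G: "\<And>k x. x \<in> S \<Longrightarrow> (G k has_real_derivative G (Suc k) x) (at x)" and "x \<in> S"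
  shows "(deriv ^^ n) (\<lambda>x. F 0 x * G 0 x) x = (\<Sum>k\<le>n. real (n choose k) * (F k x * G (n - k) x))"
  using \<open>x \<in> S\<close>
proof (induction n arbitrary: x)
  case (Suc n)
  define A where "A k = F k x * G (Suc n - k) x" for k
  have "((\<lambda>x. \<Sum>k\<le>n. real (n choose k) * (F k x * G (n - k) x)) has_real_derivative
      (\<Sum>k\<le>n. real (n choose k) * (F (Suc k) x * G (n - k) x + G (Suc (n - k)) x * F k x))) (at x)"
    by (intro DERIV_sum DERIV_cmult DERIV_mult F G Suc.prems)
  then have "((deriv ^^ n) (\<lambda>x. F 0 x * G 0 x) has_real_derivative
      (\<Sum>k\<le>n. real (n choose k) * (F (Suc k) x * G (n - k) x + G (Suc (n - k)) x * F k x))) (at x)"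
    by (rule has_field_derivative_transform_within_open[OF _ S Suc.prems]) (simp add: Suc.IH)
  then have "(deriv ^^ Suc n) (\<lambda>x. F 0 x * G 0 x) x =
      (\<Sum>k\<le>n. real (n choose k) * (F (Suc k) x * G (n - k) x + G (Suc (n - k)) x * F k x))"
    by (simp add: DERIV_imp_deriv)
  also have "\<dots> = (\<Sum>k\<le>n. real (n choose k) * A (Suc k) + real (n choose k) * A k)"
    by (rule sum.cong) (auto simp: A_def Suc_diff_le algebra_simps)
  \<comment> \<open>The extra term has the coefficient \<open>n choose Suc n\<close>, which is 0;
    after it is added, the two sums can be aligned for Pascal's rule.\<close>
  also have "\<dots> = (\<Sum>k\<le>n. real (n choose k) * A (Suc k)) + (\<Sum>k\<le>Suc n. real (n choose k) * A k)"
    by (simp add: sum.distrib)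
  also have "(\<Sum>k\<le>Suc n. real (n choose k) * A k) = A 0 + (\<Sum>k\<le>n. real (n choose Suc k) * A (Suc k))"
    by (subst sum.atMost_Suc_shift) simp
  also have "(\<Sum>k\<le>n. real (n choose k) * A (Suc k)) + (A 0 + (\<Sum>k\<le>n. real (n choose Suc k) * A (Suc k)))
      = A 0 + (\<Sum>k\<le>n. real (Suc n choose Suc k) * A (Suc k))"
    by (simp add: sum.distrib[symmetric] algebra_simps)
  also have "\<dots> = (\<Sum>k\<le>Suc n. real (Suc n choose k) * A k)"
    by (subst sum.atMost_Suc_shift) simp
  finally show ?case by (simp only: A_def)
qed simp

section \<open>Homogeneous form of the Rodrigues polynomials\<close>

definition falling :: "real \<Rightarrow> nat \<Rightarrow> real" where "falling x k = (\<Prod>j<k. x - real j)"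

lemma falling_simps: "falling x 0 = 1" "falling x (Suc k) = falling x k * (x - real k)"
  by (simp_all add: falling_def)

lemma falling_pos: "x > real k - 1 \<Longrightarrow> falling x k > 0"
  unfolding falling_def by (intro prod_pos) auto

text \<open>Leibniz coefficient when k derivatives fall on the power of t and m - k on the power of
  1 - s - t; each of the latter contributes a sign.\<close>

definition jcoef :: "nat \<Rightarrow> real \<Rightarrow> real \<Rightarrow> nat \<Rightarrow> real" where
  "jcoef m b a k = (-1) ^ (m - k) * real (m choose k) * falling (b + real m) k * falling (a + real m) (m - k)"

text \<open>Up to normalization a Jacobi polynomial homogenized in w and t, where w stands for 1 - s
  - t.\<close>

definition jac :: "nat \<Rightarrow> real \<Rightarrow> real \<Rightarrow> bfun" where
  "jac m b a w t = (\<Sum>k\<le>m. jcoef m b a k * (w ^ k * t ^ (m - k)))"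

lemma Rodrigues_eq_jac:
  assumes "0 < t" "0 < 1 - s - t"
  shows "t powr (- b) * (1 - s - t) powr (- a) *
    (deriv ^^ m) (\<lambda>\<tau>. \<tau> powr (b + real m) * (1 - s - \<tau>) powr (a + real m)) t = jac m b a (1 - s - t) t"
proof -
  define B A where "B = b + real m" and "A = a + real m"
  define F where "F k \<tau> = falling B k * \<tau> powr (B - real k)" for k \<tau>
  define G where "G k \<tau> = (-1) ^ k * falling A k * (1 - s - \<tau>) powr (A - real k)" for k \<tau>
  have F: "(F k has_real_derivative F (Suc k) \<tau>) (at \<tau>)" if "\<tau> \<in> {0<..<1 - s}" for k \<tau>
    unfolding F_def[abs_def] using that
    by (auto intro!: derivative_eq_intros simp: falling_simps algebra_simps)
  have G: "(G k has_real_derivative G (Suc k) \<tau>) (at \<tau>)" if "\<tau> \<in> {0<..<1 - s}" for k \<tau>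
    unfolding G_def[abs_def] using that
    by (auto intro!: derivative_eq_intros simp: falling_simps algebra_simps)
  have "(deriv ^^ m) (\<lambda>\<tau>. F 0 \<tau> * G 0 \<tau>) t = (\<Sum>k\<le>m. real (m choose k) * (F k t * G (m - k) t))"
    using assms by (intro deriv_funpow_mult[of "{0<..<1 - s}"] F G) auto
  moreover have "(\<lambda>\<tau>. F 0 \<tau> * G 0 \<tau>) = (\<lambda>\<tau>. \<tau> powr (b + real m) * (1 - s - \<tau>) powr (a + real m))"
    by (simp add: F_def G_def falling_simps A_def B_def)
  ultimately have "t powr (- b) * (1 - s - t) powr (- a) *
    (deriv ^^ m) (\<lambda>\<tau>. \<tau> powr (b + real m) * (1 - s - \<tau>) powr (a + real m)) t =
    (\<Sum>k\<le>m. t powr (- b) * (1 - s - t) powr (- a) * (real (m choose k) * (F k t * G (m - k) t)))"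
    by (simp add: sum_distrib_left)
  also have "\<dots> = (\<Sum>k\<le>m. jcoef m b a k * ((1 - s - t) ^ k * t ^ (m - k)))"
  proof (rule sum.cong)
    fix k assume k: "k \<in> {..m}"
    have t: "t powr (- b) * t powr (B - real k) = t ^ (m - k)"
      using assms k by (simp add: powr_add[symmetric] B_def powr_realpow[symmetric] of_nat_diff)
    have w: "(1 - s - t) powr (- a) * (1 - s - t) powr (A - real (m - k)) = (1 - s - t) ^ k"
      using assms k by (simp add: powr_add[symmetric] A_def powr_realpow[symmetric] of_nat_diff)
    show "t powr (- b) * (1 - s - t) powr (- a) * (real (m choose k) * (F k t * G (m - k) t))
      = jcoef m b a k * ((1 - s - t) ^ k * t ^ (m - k))"
      unfolding t[symmetric] w[symmetric] F_def G_def jcoef_def A_def[symmetric] B_def[symmetric]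
      by (simp only: mult_ac)
  qed simp
  finally show ?thesis by (simp only: jac_def)
qed

lemma plt_jac: "plt (Suc m) (jac m b a)"
  unfolding jac_def[abs_def] by (intro plt_sum plt_scale plt_monomial) auto

lemma plt_jac_reflected: "plt (Suc m) (\<lambda>s t. jac m b a (1 - s - t) t)"
  unfolding jac_def
proof (intro plt_sum plt_scale)
  fix k assume "k \<in> {..m}"
  then have "k + (m - k) = m" by simp
  moreover have "plt (Suc (k + (m - k))) (\<lambda>s t. (1 - s - t) ^ k * t ^ (m - k))"
    by (intro plt_mult plt_power plt_z plt_y)
  ultimately show "plt (Suc m) (\<lambda>s t. (1 - s - t) ^ k * t ^ (m - k))" by simp
qed simp

text \<open>\<open>pset\<close> prescribes values only where t and 1 - s - t are positive; this
  region contains the box, which already determines a polynomial.\<close>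

lemma pset_eq: "pset m b a = {\<lambda>s t. jac m b a (1 - s - t) t}"
proof (intro equalityI subsetI)
  fix f assume f: "f \<in> pset m b a"
  have p: "poly2 f" using f unfolding pset_def poly_le_iff_plt by (auto intro: plt_imp_poly2)
  have "(\<lambda>s t. f s t - jac m b a (1 - s - t) t) = (\<lambda>s t. 0)"
  proof (rule poly2_zero_on_box)
    show "poly2 (\<lambda>s t. f s t - jac m b a (1 - s - t) t)"
      by (intro poly2_diff p plt_imp_poly2[OF plt_jac_reflected])
    show "f s t - jac m b a (1 - s - t) t = 0" if "0 < s" "s < 1/2" "0 < t" "t < 1/2" for s t
      using f that unfolding pset_def by (simp add: Rodrigues_eq_jac)
  qed
  then show "f \<in> {\<lambda>s t. jac m b a (1 - s - t) t}" by (simp add: fun_eq_iff)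
next
  fix f assume "f \<in> {\<lambda>s t. jac m b a (1 - s - t) t}"
  then show "f \<in> pset m b a"
    by (auto simp: pset_def poly_le_iff_plt plt_jac_reflected Rodrigues_eq_jac)
qed

lemma jac_1_0: "jac m b a 1 0 = jcoef m b a m"
proof -
  have "jac m b a 1 0 = (\<Sum>k\<le>m. if k = m then jcoef m b a m else 0)"
    unfolding jac_def by (rule sum.cong) (auto simp: power_0_left)
  then show ?thesis by simp
qed

lemma jac_0_1: "jac m b a 0 1 = jcoef m b a 0"
proof -
  have "jac m b a 0 1 = (\<Sum>k\<le>m. if k = 0 then jcoef m b a 0 else 0)"
    unfolding jac_def by (rule sum.cong) (auto simp: power_0_left)
  then show ?thesis by simp
qed

text \<open>The factors of the falling factorial are b + 1, ..., b + m, all positive.\<close>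

lemma jac_1_0_nonzero: "b > -1 \<Longrightarrow> jac m b a 1 0 \<noteq> 0"
  unfolding jac_1_0 jcoef_def using falling_pos[of m "b + real m"] by (simp add: falling_simps)

lemma jac_0_1_nonzero: "a > -1 \<Longrightarrow> jac m b a 0 1 \<noteq> 0"
  unfolding jac_0_1 jcoef_def using falling_pos[of m "a + real m"] by (simp add: falling_simps)

text \<open>The ratio of consecutive coefficients is precisely the one for which neighbouring
  degree-lowering terms of \<open>Lop_monomial\<close> cancel.\<close>

lemma jcoef_Suc:
  assumes "k < m"
  shows "jcoef m b a (Suc k) * (real (Suc k) * (real (Suc k) + a)) = - (jcoef m b a k * (real (m - k) * (real (m - k) + b)))"
proof -
  obtain r where r: "m = Suc (k + r)" using assms less_iff_Suc_add by blast
  have "Suc k * (m choose Suc k) = (m - k) * (m choose k)"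
    by (simp only: binomial_absorption binomial_absorb_comp)
  then have c: "real (m choose Suc k) * real (Suc k) = real (m choose k) * real (m - k)"
    by (metis of_nat_mult mult.commute)
  have 1: "falling (b + real m) (Suc k) = falling (b + real m) k * (real (m - k) + b)"
    using r by (simp add: falling_simps)
  have 2: "falling (a + real m) (m - k) = falling (a + real m) (m - Suc k) * (real (Suc k) + a)"
    using r by (simp add: falling_simps)
  have 3: "(-1 :: real) ^ (m - k) = - ((-1) ^ (m - Suc k))"
    using r by simp
  have "jcoef m b a (Suc k) * (real (Suc k) * (real (Suc k) + a))
    = (-1) ^ (m - Suc k) * (real (m choose Suc k) * real (Suc k)) * falling (b + real m) k * (real (m - k) + b)
      * falling (a + real m) (m - Suc k) * (real (Suc k) + a)"
    unfolding jcoef_def 1 by (simp only: mult_ac)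
  also have "\<dots> = - (jcoef m b a k * (real (m - k) * (real (m - k) + b)))"
    unfolding c jcoef_def 2 3 by (simp only: mult_ac mult_minus_left mult_minus_right)
  finally show ?thesis .
qed

lemma Lop_sum:
  assumes "finite S" "\<And>s. s \<in> S \<Longrightarrow> poly2 (F s)"
  shows "poly2 (\<lambda>x y. \<Sum>s\<in>S. F s x y)" "Lop a b c (\<lambda>x y. \<Sum>s\<in>S. F s x y) = (\<lambda>x y. \<Sum>s\<in>S. Lop a b c (F s) x y)"
proof -
  have "poly2 (\<lambda>x y. \<Sum>s\<in>S. F s x y) \<and>
      Lop a b c (\<lambda>x y. \<Sum>s\<in>S. F s x y) = (\<lambda>x y. \<Sum>s\<in>S. Lop a b c (F s) x y)"
    using assms by (induction S rule: finite_induct) (auto simp: Lop_zero poly2_zero Lop_add intro: poly2_add)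
  then show "poly2 (\<lambda>x y. \<Sum>s\<in>S. F s x y)"
    "Lop a b c (\<lambda>x y. \<Sum>s\<in>S. F s x y) = (\<lambda>x y. \<Sum>s\<in>S. Lop a b c (F s) x y)" by auto
qed

text \<open>The sums \<open>P\<close> and \<open>Q\<close> collect the degree-lowering terms; they cancel, so the third
  parameter \<open>c\<close>, which occurs only in \<open>eigval\<close>, is arbitrary.\<close>

lemma jac_Eig: "jac m b a \<in> Eig a b c m"
proof (rule EigI[OF plt_jac])
  fix x y
  define P where "P k = jcoef m b a k * (real k * (real k + a)) * (x ^ (k - 1) * y ^ (m - k))" for k
  define Q where "Q k = jcoef m b a k * (real (m - k) * (real (m - k) + b)) * (x ^ k * y ^ (m - k - 1))" for k
  have PQ: "P (Suc k) = - Q k" if "k < m" for k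
    unfolding P_def Q_def jcoef_Suc[OF that] by simp
  have "(\<Sum>k\<le>m. P k) + (\<Sum>k\<le>m. Q k) = 0"
  proof (cases m)
    case (Suc n)
    have "(\<Sum>k\<le>m. P k) = (\<Sum>k\<le>n. P (Suc k))"
      unfolding Suc by (subst sum.atMost_Suc_shift) (simp add: P_def)
    moreover have "(\<Sum>k\<le>m. Q k) = (\<Sum>k\<le>n. Q k)" unfolding Suc by (simp add: Q_def Suc)
    moreover have "(\<Sum>k\<le>n. P (Suc k)) + (\<Sum>k\<le>n. Q k) = 0"
      unfolding sum.distrib[symmetric] by (rule sum.neutral) (simp add: PQ Suc)
    ultimately show ?thesis by simp
  qed (simp add: P_def Q_def)
  moreover have "Lop a b c (jac m b a) x y = (\<Sum>k\<le>m. - eigval a b c m * (jcoef m b a k * (x ^ k * y ^ (m - k))) + P k + Q k)"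
  proof -
    have "Lop a b c (\<lambda>x y. jcoef m b a k * (x ^ k * y ^ (m - k))) x y
      = - eigval a b c m * (jcoef m b a k * (x ^ k * y ^ (m - k))) + P k + Q k" if "k \<in> {..m}" for k
    proof -
      have "k + (m - k) = m" using that by simp
      then show ?thesis
        unfolding Lop_scale[OF poly2_monomial] Lop_monomial P_def Q_def by (simp only:) (simp add: algebra_simps)
    qed
    moreover have "Lop a b c (jac m b a) x y = (\<Sum>k\<le>m. Lop a b c (\<lambda>x y. jcoef m b a k * (x ^ k * y ^ (m - k))) x y)"
      unfolding jac_def[abs_def] by (subst Lop_sum) (intro finite_atMost poly2_scale poly2_monomial refl)+
    ultimately show ?thesis by (simp only: cong: sum.cong)
  qed
  ultimately show "Lop a b c (jac m b a) x y = - eigval a b c m * jac m b a x y"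
    unfolding jac_def sum.distrib sum_distrib_left by simp
qed

section \<open>Symmetries and multiplication by barycentric coordinates\<close>

definition swp :: "bfun \<Rightarrow> bfun" where "swp f = (\<lambda>x y. f y x)"

text \<open>Exchanges the barycentric coordinates y and 1 - x - y; with \<open>swp\<close> it
  generates all permutations of the three coordinates.\<close>

definition rfl :: "bfun \<Rightarrow> bfun" where "rfl f = (\<lambda>x y. f x (1 - x - y))"

lemma plt_swp: "plt m f \<Longrightarrow> plt m (swp f)"
proof (induction rule: plt_induct)
  case (monomial i j)
  then show ?case using plt_monomial[of j i m] by (simp add: swp_def mult.commute)
qed (auto simp: swp_def intro: plt_zero plt_add plt_scale)

lemma plt_rfl: "plt m f \<Longrightarrow> plt m (rfl f)"
proof (induction rule: plt_induct)
  case (monomial i j)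
  have "plt (Suc (i + j)) (\<lambda>x y. x ^ i * (1 - x - y) ^ j)"
    by (intro plt_mult plt_power plt_x plt_z)
  then show ?case using monomial by (auto simp: rfl_def intro: plt_mono)
qed (auto simp: rfl_def intro: plt_zero plt_add plt_scale)

text \<open>\<open>Lop\<close> contains the mixed derivative in one fixed order, so its symmetry
  rests on \<open>dx_dy_commute\<close>.\<close>

lemma Eig_swp:
  assumes "f \<in> Eig a b c n"
  shows "swp f \<in> Eig b a c n"
proof (rule EigI[OF plt_swp[OF EigD(1)[OF assms]]])
  fix x y
  have x: "dx (swp g) = swp (dy g)" and y: "dy (swp g) = swp (dx g)" for g
    by (simp_all add: fun_eq_iff swp_def dx_def dy_def)
  have "Lop b a c (swp f) x y = Lop a b c f y x"
    unfolding Lop_def x y using dx_dy_commute[OF EigD(2)[OF assms]]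
    by (simp add: swp_def algebra_simps)
  then show "Lop b a c (swp f) x y = - eigval b a c n * swp f x y"
    unfolding EigD(3)[OF assms] by (simp add: eigval_def swp_def algebra_simps)
qed

text \<open>The chain rule, obtained from monomials by linearity.\<close>

lemma dx_rfl: "poly2 f \<Longrightarrow> dx (rfl f) = rfl (\<lambda>x y. dx f x y - dy f x y)"
  and dy_rfl: "poly2 f \<Longrightarrow> dy (rfl f) = rfl (\<lambda>x y. - dy f x y)"
proof -
  have "((\<lambda>s. rfl f s y) has_real_derivative rfl (\<lambda>x y. dx f x y - dy f x y) x y) (at x) \<and>
    ((\<lambda>t. rfl f x t) has_real_derivative rfl (\<lambda>x y. - dy f x y) x y) (at y)" if "poly2 f" for x y
    using that
  proof (induction rule: poly2_induct)
    case (monomial i j)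
    then show ?case
      by (auto intro!: derivative_eq_intros simp: rfl_def dx_monomial dy_monomial)
  next
    case (add f g)
    from DERIV_add[OF conjunct1[OF add.IH(1)] conjunct1[OF add.IH(2)]]
      DERIV_add[OF conjunct2[OF add.IH(1)] conjunct2[OF add.IH(2)]] add.hyps
    show ?case by (simp add: rfl_def dx_add dy_add algebra_simps)
  next
    case (scale k f)
    from DERIV_cmult[OF conjunct1[OF scale.IH], of k] DERIV_cmult[OF conjunct2[OF scale.IH], of k] scale.hyps
    show ?case by (simp add: rfl_def dx_scale dy_scale algebra_simps)
  qed (simp add: rfl_def dx_const dy_const)
  then show "poly2 f \<Longrightarrow> dx (rfl f) = rfl (\<lambda>x y. dx f x y - dy f x y)"
    "poly2 f \<Longrightarrow> dy (rfl f) = rfl (\<lambda>x y. - dy f x y)"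
    by (auto intro!: dx_eqI dy_eqI)
qed

lemma Eig_rfl:
  assumes "f \<in> Eig a b c n"
  shows "rfl f \<in> Eig a c b n"
proof (rule EigI[OF plt_rfl[OF EigD(1)[OF assms]]])
  fix x y
  have p: "poly2 f" using assms by (rule EigD)
  have p': "poly2 (\<lambda>x y. dx f x y - dy f x y)" "poly2 (\<lambda>x y. - dy f x y)"
    using p poly2_scale[of "dy f" "-1"] by (auto intro: poly2_diff poly2_dx poly2_dy)
  have m: "dx (\<lambda>x y. - dy f x y) = (\<lambda>x y. - dx (dy f) x y)" "dy (\<lambda>x y. - dy f x y) = (\<lambda>x y. - dy (dy f) x y)"
    using dx_scale[OF poly2_dy[OF p], of "-1"] dy_scale[OF poly2_dy[OF p], of "-1"] by auto
  have "Lop a c b (rfl f) x y = Lop a b c f x (1 - x - y)"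
    unfolding Lop_def dx_rfl[OF p] dy_rfl[OF p] dx_rfl[OF p'(1)] dx_rfl[OF p'(2)] dy_rfl[OF p'(1)] dy_rfl[OF p'(2)]
      dx_diff[OF poly2_dx[OF p] poly2_dy[OF p]] dy_diff[OF poly2_dx[OF p] poly2_dy[OF p]] m dx_dy_commute[OF p]
    by (simp add: rfl_def algebra_simps)
  then show "Lop a c b (rfl f) x y = - eigval a c b n * rfl f x y"
    unfolding EigD(3)[OF assms] by (simp add: eigval_def rfl_def algebra_simps)
qed

lemma dx_mult: "poly2 f \<Longrightarrow> poly2 g \<Longrightarrow> dx (\<lambda>x y. f x y * g x y) = (\<lambda>x y. f x y * dx g x y + dx f x y * g x y)"
  by (rule dx_eqI) (auto intro!: derivative_eq_intros poly2_DERIV_dx)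

lemma dy_mult: "poly2 f \<Longrightarrow> poly2 g \<Longrightarrow> dy (\<lambda>x y. f x y * g x y) = (\<lambda>x y. f x y * dy g x y + dy f x y * g x y)"
  by (rule dy_eqI) (auto intro!: derivative_eq_intros poly2_DERIV_dy)

text \<open>With z = 1 - x - y, the operator for c = -1 maps z f to z times (the operator for c = 1
  applied to f, minus (a + b + 2) f). The shift fits because n (n + a + b + 3) + a + b + 2 = (n + 1)
  (n + a + b + 2).\<close>

lemma Eig_mult_z:
  assumes "f \<in> Eig a b 1 n"
  shows "(\<lambda>x y. (1 - x - y) * f x y) \<in> Eig a b (-1) (Suc n)"
proof (rule EigI)
  show "plt (Suc (Suc n)) (\<lambda>x y. (1 - x - y) * f x y)"
    using plt_mult[OF plt_z[of 0] EigD(1)[OF assms]] by simp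
  fix x y
  have p: "poly2 f" using assms by (rule EigD)
  have z: "dx (\<lambda>x y. 1 - x - y) = (\<lambda>x y. - 1)" "dy (\<lambda>x y. 1 - x - y) = (\<lambda>x y. - 1)"
    by (auto intro!: dx_eqI dy_eqI derivative_eq_intros)
  have 1: "dx (\<lambda>x y. (1 - x - y) * f x y) = (\<lambda>x y. (1 - x - y) * dx f x y - f x y)"
    "dy (\<lambda>x y. (1 - x - y) * f x y) = (\<lambda>x y. (1 - x - y) * dy f x y - f x y)"
    using p by (simp_all add: dx_mult dy_mult z poly2_z)
  have 2: "dx (\<lambda>x y. (1 - x - y) * dx f x y - f x y) = (\<lambda>x y. (1 - x - y) * dx (dx f) x y - 2 * dx f x y)"
    "dy (\<lambda>x y. (1 - x - y) * dx f x y - f x y) = (\<lambda>x y. (1 - x - y) * dy (dx f) x y - dx f x y - dy f x y)"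
    "dy (\<lambda>x y. (1 - x - y) * dy f x y - f x y) = (\<lambda>x y. (1 - x - y) * dy (dy f) x y - 2 * dy f x y)"
    using p by (simp_all add: dx_diff dy_diff dx_mult dy_mult z poly2_z poly2_mult poly2_dx poly2_dy)
  have "Lop a b (-1) (\<lambda>x y. (1 - x - y) * f x y) x y = (1 - x - y) * (Lop a b 1 f x y - (a + b + 2) * f x y)"
    unfolding Lop_def 1 2 by (simp add: algebra_simps)
  then show "Lop a b (-1) (\<lambda>x y. (1 - x - y) * f x y) x y = - eigval a b (-1) (Suc n) * ((1 - x - y) * f x y)"
    unfolding EigD(3)[OF assms] by (simp add: eigval_def algebra_simps)
qed

lemma Eig_mult_y:
  assumes "f \<in> Eig a 1 c n"
  shows "(\<lambda>x y. y * f x y) \<in> Eig a (-1) c (Suc n)"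
  using Eig_rfl[OF Eig_mult_z[OF Eig_rfl[OF assms]]] by (simp add: rfl_def)

lemma Eig_mult_x:
  assumes "f \<in> Eig 1 b c n"
  shows "(\<lambda>x y. x * f x y) \<in> Eig (-1) b c (Suc n)"
  using Eig_swp[OF Eig_mult_y[OF Eig_swp[OF assms]]] by (simp add: swp_def)


section \<open>Dimensions and direct sums\<close>

text \<open>Coordinates indexed by all natural numbers, with only the first k used, are easier to
  rescale and concatenate than lists of fixed length.\<close>

lemma has_dim_iff:
  "has_dim U k \<longleftrightarrow> (\<exists>b :: nat \<Rightarrow> bfun.
     (\<forall>c. (\<forall>x y. (\<Sum>i<k. c i * b i x y) = 0) \<longrightarrow> (\<forall>i<k. c i = 0))
     \<and> U = {(\<lambda>x y. \<Sum>i<k. c i * b i x y) | c. True})" (is "_ \<longleftrightarrow> (\<exists>b. ?ind b \<and> U = ?span b)")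
proof
  assume "has_dim U k"
  then obtain bs :: "bfun list" where bs: "length bs = k"
    "\<And>cs :: real list. length cs = k \<Longrightarrow> (\<forall>x y. (\<Sum>i<k. cs ! i * (bs ! i) x y) = 0) \<Longrightarrow> (\<forall>i<k. cs ! i = 0)"
    "U = {(\<lambda>x y. \<Sum>i<k. cs ! i * (bs ! i) x y) | cs. length cs = k}"
    unfolding has_dim_def by blast
  have m: "(\<Sum>i<k. map c [0..<k] ! i * (bs ! i) x y) = (\<Sum>i<k. c i * (bs ! i) x y)" for c x y
    by (rule sum.cong) auto
  have "?ind (\<lambda>i. bs ! i)"
  proof (intro allI impI)
    fix c i assume "\<forall>x y. (\<Sum>i<k. c i * (bs ! i) x y) = 0" "i < k"
    then show "c i = 0" using bs(2)[of "map c [0..<k]"] unfolding m by auto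
  qed
  moreover have "U = ?span (\<lambda>i. bs ! i)"
  proof (intro equalityI subsetI)
    fix u assume "u \<in> ?span (\<lambda>i. bs ! i)"
    then obtain c where "u = (\<lambda>x y. \<Sum>i<k. map c [0..<k] ! i * (bs ! i) x y)" unfolding m by blast
    then show "u \<in> U" unfolding bs(3) by (intro CollectI exI[of _ "map c [0..<k]"]) simp
  qed (use bs(3) in blast)
  ultimately show "\<exists>b. ?ind b \<and> U = ?span b" by blast
next
  assume "\<exists>b. ?ind b \<and> U = ?span b"
  then obtain b where b: "?ind b" "U = ?span b" by blast
  have m: "(\<Sum>i<k. cs ! i * (map b [0..<k] ! i) x y) = (\<Sum>i<k. cs ! i * b i x y)" for cs x y
    by (rule sum.cong) auto
  have m': "(\<Sum>i<k. map c [0..<k] ! i * b i x y) = (\<Sum>i<k. c i * b i x y)" for c x y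
    by (rule sum.cong) auto
  have d: "(\<Sum>j<k. (if j = i then 1 else 0) * b j x y) = b i x y" if "i < k" for i x y
  proof -
    have "(\<Sum>j<k. (if j = i then 1 else 0) * b j x y) = (\<Sum>j<k. if j = i then b i x y else 0)"
      by (rule sum.cong) auto
    then show ?thesis using that by simp
  qed
  show "has_dim U k" unfolding has_dim_def
  proof (intro exI[of _ "map b [0..<k]"] conjI allI impI)
    show "map b [0..<k] ! i \<in> U" if "i < k" for i
    proof -
      have "b i = (\<lambda>x y. \<Sum>j<k. (if j = i then 1 else 0) * b j x y)" using d[OF that] by simp
      then show ?thesis unfolding b(2) using that by (intro CollectI exI[of _ "\<lambda>j. if j = i then 1 else 0"]) simp
    qed
    show "cs ! i = 0" if "length cs = k \<and> (\<forall>x y. (\<Sum>i<k. cs ! i * (map b [0..<k] ! i) x y) = 0)" "i < k" for cs i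
      using that b(1)[rule_format, of "\<lambda>i. cs ! i"] unfolding m by blast
    show "U = {\<lambda>x y. \<Sum>i<k. cs ! i * (map b [0..<k] ! i) x y |cs. length cs = k}"
      unfolding b(2) m
    proof (intro equalityI subsetI)
      fix u assume "u \<in> ?span b"
      then obtain c where "u = (\<lambda>x y. \<Sum>i<k. map c [0..<k] ! i * b i x y)" unfolding m' by blast
      then show "u \<in> {\<lambda>x y. \<Sum>i<k. cs ! i * b i x y |cs. length cs = k}"
        by (intro CollectI exI[of _ "map c [0..<k]"]) simp
    qed blast
  qed simp
qed

lemma has_dim_zero: "has_dim {\<lambda>x y. 0} 0"
  unfolding has_dim_iff by auto

text \<open>Multiplication by \<open>h\<close> is injective on polynomials, since \<open>h\<close>
  has no zero on the box.\<close>

lemma has_dim_mulsp: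
  assumes "has_dim A k" and A: "\<And>f. f \<in> A \<Longrightarrow> poly2 f"
    and h: "\<And>x y. 0 < x \<Longrightarrow> x < 1 / 2 \<Longrightarrow> 0 < y \<Longrightarrow> y < 1 / 2 \<Longrightarrow> h x y \<noteq> 0"
  shows "has_dim (mulsp h A) k"
proof -
  from assms(1) obtain b where ind: "\<And>c. (\<forall>x y. (\<Sum>i<k. c i * b i x y) = 0) \<Longrightarrow> (\<forall>i<k. c i = 0)"
    and span: "A = {(\<lambda>x y. \<Sum>i<k. c i * b i x y) | c. True}" unfolding has_dim_iff by blast
  have eq: "(\<Sum>i<k. c i * (h x y * b i x y)) = h x y * (\<Sum>i<k. c i * b i x y)" for c x y
    by (simp add: sum_distrib_left mult.left_commute)
  show ?thesis unfolding has_dim_iff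
  proof (intro exI[of _ "\<lambda>i x y. h x y * b i x y"] conjI allI impI)
    fix c i assume z: "\<forall>x y. (\<Sum>i<k. c i * (h x y * b i x y)) = 0" and i: "i < k"
    have "(\<lambda>x y. \<Sum>i<k. c i * b i x y) = (\<lambda>x y. 0)"
    proof (rule poly2_zero_on_box)
      show "poly2 (\<lambda>x y. \<Sum>i<k. c i * b i x y)" using A span by blast
      show "(\<Sum>i<k. c i * b i x y) = 0" if "0 < x" "x < 1/2" "0 < y" "y < 1/2" for x y
        using z[rule_format, of x y] h[OF that] unfolding eq by simp
    qed
    then have "\<forall>x y. (\<Sum>i<k. c i * b i x y) = 0" by (simp add: fun_eq_iff)
    then show "c i = 0" using ind i by blast
  next
    show "mulsp h A = {(\<lambda>x y. \<Sum>i<k. c i * (h x y * b i x y)) |c. True}"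
    proof (intro equalityI subsetI)
      fix u assume "u \<in> mulsp h A"
      then obtain f where "u = (\<lambda>x y. h x y * f x y)" "f \<in> A" unfolding mulsp_def by auto
      moreover from \<open>f \<in> A\<close> obtain c where "f = (\<lambda>x y. \<Sum>i<k. c i * b i x y)" unfolding span by auto
      ultimately show "u \<in> {(\<lambda>x y. \<Sum>i<k. c i * (h x y * b i x y)) |c. True}"
        unfolding eq by (intro CollectI exI[of _ c]) simp
    next
      fix u assume "u \<in> {(\<lambda>x y. \<Sum>i<k. c i * (h x y * b i x y)) |c. True}"
      then obtain c where u: "u = (\<lambda>x y. h x y * (\<Sum>i<k. c i * b i x y))" unfolding eq by auto
      have "(\<lambda>x y. \<Sum>i<k. c i * b i x y) \<in> A" unfolding span by (intro CollectI exI[of _ c]) simp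
      then show "u \<in> mulsp h A"
        unfolding mulsp_def u by (intro CollectI exI[of _ "\<lambda>x y. \<Sum>i<k. c i * b i x y"]) simp
    qed
  qed
qed

lemma sum_lessThan_add: "(\<Sum>i<k + l. g i) = (\<Sum>i<k. g i) + (\<Sum>i<l. g (k + i))" for g :: "nat \<Rightarrow> real"
  by (induction l) (simp_all add: add.assoc)

lemma has_dim_plus:
  assumes "has_dim A k" "has_dim B l"
    and d: "\<And>f g. f \<in> A \<Longrightarrow> g \<in> B \<Longrightarrow> (\<forall>x y. f x y + g x y = 0) \<Longrightarrow> f = (\<lambda>x y. 0)"
  shows "has_dim {\<lambda>x y. f x y + g x y | f g. f \<in> A \<and> g \<in> B} (k + l)"
proof -
  from assms(1) obtain b where ind: "\<And>c. (\<forall>x y. (\<Sum>i<k. c i * b i x y) = 0) \<Longrightarrow> (\<forall>i<k. c i = 0)"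
    and span: "A = {(\<lambda>x y. \<Sum>i<k. c i * b i x y) | c. True}" unfolding has_dim_iff by blast
  from assms(2) obtain b' where ind': "\<And>c. (\<forall>x y. (\<Sum>i<l. c i * b' i x y) = 0) \<Longrightarrow> (\<forall>i<l. c i = 0)"
    and span': "B = {(\<lambda>x y. \<Sum>i<l. c i * b' i x y) | c. True}" unfolding has_dim_iff by blast
  \<comment> \<open>The two bases placed one after the other.\<close>
  define e where "e i = (if i < k then b i else b' (i - k))" for i
  have eq: "(\<Sum>i<k + l. c i * e i x y) = (\<Sum>i<k. c i * b i x y) + (\<Sum>i<l. c (k + i) * b' i x y)" for c x y
    unfolding sum_lessThan_add by (simp add: e_def)
  show ?thesis unfolding has_dim_iff
  proof (intro exI[of _ e] conjI allI impI)
    fix c i assume z: "\<forall>x y. (\<Sum>i<k + l. c i * e i x y) = 0" and i: "i < k + l"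
    have "(\<lambda>x y. \<Sum>i<k. c i * b i x y) = (\<lambda>x y. 0)"
    proof (rule d)
      show "(\<lambda>x y. \<Sum>i<k. c i * b i x y) \<in> A" unfolding span by blast
      show "(\<lambda>x y. \<Sum>i<l. c (k + i) * b' i x y) \<in> B"
        unfolding span' by (intro CollectI exI[of _ "\<lambda>i. c (k + i)"]) simp
    qed (use z in \<open>simp add: eq\<close>)
    then have 1: "\<forall>x y. (\<Sum>i<k. c i * b i x y) = 0" by (simp add: fun_eq_iff)
    with z have 2: "\<forall>x y. (\<Sum>i<l. c (k + i) * b' i x y) = 0" by (simp add: eq)
    show "c i = 0"
    proof (cases "i < k")
      case False
      then have "i - k < l" using i by simp
      then have "c (k + (i - k)) = 0" using ind'[OF 2] by blast
      with False show ?thesis by simp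
    qed (use ind[OF 1] in simp)
  next
    show "{\<lambda>x y. f x y + g x y | f g. f \<in> A \<and> g \<in> B} = {\<lambda>x y. \<Sum>i<k + l. c i * e i x y |c. True}"
    proof (intro equalityI subsetI)
      fix u assume "u \<in> {\<lambda>x y. f x y + g x y | f g. f \<in> A \<and> g \<in> B}"
      then obtain c c' where u: "u = (\<lambda>x y. (\<Sum>i<k. c i * b i x y) + (\<Sum>i<l. c' i * b' i x y))"
        unfolding span span' by blast
      show "u \<in> {\<lambda>x y. \<Sum>i<k + l. c i * e i x y |c. True}"
        unfolding eq u by (intro CollectI exI[of _ "\<lambda>i. if i < k then c i else c' (i - k)"]) simp
    next
      fix u assume "u \<in> {\<lambda>x y. \<Sum>i<k + l. c i * e i x y |c. True}"
      then obtain c where u: "u = (\<lambda>x y. (\<Sum>i<k. c i * b i x y) + (\<Sum>i<l. c (k + i) * b' i x y))"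
        unfolding eq by blast
      have "(\<lambda>x y. \<Sum>i<k. c i * b i x y) \<in> A" unfolding span by blast
      moreover have "(\<lambda>x y. \<Sum>i<l. c (k + i) * b' i x y) \<in> B"
        unfolding span' by (intro CollectI exI[of _ "\<lambda>i. c (k + i)"]) simp
      ultimately show "u \<in> {\<lambda>x y. f x y + g x y | f g. f \<in> A \<and> g \<in> B}"
        unfolding u by (intro CollectI exI[of _ "\<lambda>x y. \<Sum>i<k. c i * b i x y"] exI[of _ "\<lambda>x y. \<Sum>i<l. c (k + i) * b' i x y"]) simp
    qed
  qed
qed

section \<open>Sums of several spaces, one summand at a time\<close>

lemma sumsp_Nil: "sumsp [] = {\<lambda>x y. 0}"
  unfolding sumsp_def by auto

lemma sumsp_Cons: "sumsp (A # As) = {\<lambda>x y. f x y + g x y | f g. f \<in> A \<and> g \<in> sumsp As}"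
proof (intro equalityI subsetI)
  fix u assume "u \<in> sumsp (A # As)"
  then obtain fs where fs: "u = (\<lambda>x y. \<Sum>i<length (A # As). (fs ! i) x y)"
    "length fs = length (A # As)" "\<forall>i<length (A # As). fs ! i \<in> (A # As) ! i" unfolding sumsp_def by blast
  obtain f gs where "fs = f # gs" using fs(2) by (cases fs) auto
  with fs have "u = (\<lambda>x y. f x y + (\<Sum>i<length As. (gs ! i) x y))" "f \<in> A" "length gs = length As"
    "\<forall>i<length As. gs ! i \<in> As ! i"
    by (auto simp: sum.lessThan_Suc_shift simp del: sum.lessThan_Suc)
  moreover from this have "(\<lambda>x y. \<Sum>i<length As. (gs ! i) x y) \<in> sumsp As"
    unfolding sumsp_def by (intro CollectI exI[of _ gs]) simp
  ultimately show "u \<in> {\<lambda>x y. f x y + g x y | f g. f \<in> A \<and> g \<in> sumsp As}"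
    by (intro CollectI exI[of _ f] exI[of _ "\<lambda>x y. \<Sum>i<length As. (gs ! i) x y"]) simp
next
  fix u assume "u \<in> {\<lambda>x y. f x y + g x y | f g. f \<in> A \<and> g \<in> sumsp As}"
  then obtain f gs where "u = (\<lambda>x y. f x y + (\<Sum>i<length As. (gs ! i) x y))" "f \<in> A" "length gs = length As"
    "\<forall>i<length As. gs ! i \<in> As ! i" unfolding sumsp_def by blast
  then show "u \<in> sumsp (A # As)" unfolding sumsp_def
    by (intro CollectI exI[of _ "f # gs"])
      (auto simp: sum.lessThan_Suc_shift nth_Cons split: nat.split simp del: sum.lessThan_Suc)
qed

lemma direct_Nil: "direct []"
  unfolding direct_def by simp

lemma direct_Cons:
  assumes "direct As"
    and d: "\<And>f g. f \<in> A \<Longrightarrow> g \<in> sumsp As \<Longrightarrow> (\<forall>x y. f x y + g x y = 0) \<Longrightarrow> f = (\<lambda>x y. 0)"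
  shows "direct (A # As)"
  unfolding direct_def
proof (intro allI impI, elim conjE)
  fix fs :: "bfun list" and i
  assume fs: "length fs = length (A # As)" "\<forall>i<length (A # As). fs ! i \<in> (A # As) ! i"
    "\<forall>x y. (\<Sum>i<length (A # As). (fs ! i) x y) = 0" and i: "i < length (A # As)"
  obtain f gs where f: "fs = f # gs" using fs(1) by (cases fs) auto
  with fs have g: "length gs = length As" "f \<in> A" "\<forall>i<length As. gs ! i \<in> As ! i"
    "\<forall>x y. f x y + (\<Sum>i<length As. (gs ! i) x y) = 0"
    by (auto simp: sum.lessThan_Suc_shift simp del: sum.lessThan_Suc)
  have f0: "f = (\<lambda>x y. 0)"
  proof (rule d[OF g(2) _ g(4)])
    show "(\<lambda>x y. \<Sum>i<length As. (gs ! i) x y) \<in> sumsp As"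
      unfolding sumsp_def using g by (intro CollectI exI[of _ gs]) simp
  qed
  have "\<forall>x y. (\<Sum>i<length As. (gs ! i) x y) = 0" using g(4) unfolding f0 by simp
  with g(1,3) have "\<forall>i<length As. gs ! i = (\<lambda>x y. 0)"
    using assms(1)[unfolded direct_def, THEN spec, of gs] by blast
  then show "fs ! i = (\<lambda>x y. 0)" using f f0 i by (cases i) auto
qed

text \<open>Directness and dimension rest on the same separation of the first summand from the
  others, so they are carried together.\<close>

lemma sumsp_Cons_direct:
  assumes "has_dim A k" "direct As \<and> has_dim (sumsp As) l"
    and "\<And>f g. f \<in> A \<Longrightarrow> g \<in> sumsp As \<Longrightarrow> (\<forall>x y. f x y + g x y = 0) \<Longrightarrow> f = (\<lambda>x y. 0)"
  shows "direct (A # As) \<and> has_dim (sumsp (A # As)) (k + l)"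
  using assms unfolding sumsp_Cons by (intro conjI direct_Cons has_dim_plus) auto

lemma sumsp_single_direct:
  assumes "has_dim A k"
  shows "direct [A] \<and> has_dim (sumsp [A]) k"
proof -
  have "direct [A] \<and> has_dim (sumsp [A]) (k + 0)"
    by (rule sumsp_Cons_direct[OF assms]) (auto simp: direct_Nil sumsp_Nil has_dim_zero fun_eq_iff)
  then show ?thesis by simp
qed

lemma sumsp_subset_Eig: "(\<And>A. A \<in> set As \<Longrightarrow> A \<subseteq> Eig a b c n) \<Longrightarrow> sumsp As \<subseteq> Eig a b c n"
proof (induction As)
  case (Cons A As)
  then show ?case unfolding sumsp_Cons by (auto intro!: Eig_add)
qed (simp add: sumsp_Nil Eig_zero)

section \<open>The summands of the theorem as explicit spaces\<close>

definition ray :: "bfun \<Rightarrow> bfun set" where "ray f = {\<lambda>x y. k * f x y | k. True}"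

lemma has_dim_ray: "f \<noteq> (\<lambda>x y. 0) \<Longrightarrow> has_dim (ray f) 1"
  unfolding has_dim_iff ray_def
  by (intro exI[of _ "\<lambda>i. f"]) (auto simp: fun_eq_iff intro: exI[of _ "\<lambda>i. _"])

lemma H3_eq: "H3 (int m) a b = ray (jac m b a)"
  unfolding H3_def pset_eq ray_def by auto

text \<open>Exchanging x and y produces 1 - y - x; this restores the standard form of the third
  coordinate.\<close>

lemma flip_z: "(\<lambda>x y. F (1 - y - x) x y) = (\<lambda>x y. F (1 - x - y) x y)" for F :: "real \<Rightarrow> bfun"
proof (intro ext)
  fix x y :: real
  have "1 - y - x = 1 - x - y" by simp
  then show "F (1 - y - x) x y = F (1 - x - y) x y" by (rule arg_cong[where f = "\<lambda>t. F t x y"])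
qed

lemma H2_eq: "H2 (int m) a b = ray (\<lambda>x y. jac m b a (1 - x - y) x)"
proof -
  have "(\<lambda>x y. k * jac m b a (1 - y - x) x) = (\<lambda>x y. k * jac m b a (1 - x - y) x)" for k
    by (rule flip_z)
  then show ?thesis unfolding H2_def pset_eq ray_def by simp
qed

lemma H1_eq: "H1 (int m) a b = ray (\<lambda>x y. jac m b a (1 - x - y) y)"
  unfolding H1_def pset_eq ray_def by auto

lemma mulsp_ray: "mulsp h (ray f) = ray (\<lambda>x y. h x y * f x y)"
proof -
  have "(\<lambda>x y. h x y * (k * f x y)) = (\<lambda>x y. k * (h x y * f x y))" for k
    by (intro ext) simp
  then show ?thesis unfolding mulsp_def ray_def by (auto simp: fun_eq_iff)
qed

lemma ray_subset_Eig: "f \<in> Eig a b c n \<Longrightarrow> ray f \<subseteq> Eig a b c n"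
  unfolding ray_def by (auto intro: Eig_scale)

text \<open>The free parameter \<open>c\<close> travels with the coordinate that does not occur in
  the polynomial, here y.\<close>

lemma jac_zx_Eig: "(\<lambda>x y. jac m b a (1 - x - y) x) \<in> Eig b c a m"
  using Eig_rfl[OF Eig_swp[OF jac_Eig[of m b a c]]] by (simp add: rfl_def swp_def)

lemma jac_zy_Eig: "(\<lambda>x y. jac m b a (1 - x - y) y) \<in> Eig c b a m"
proof -
  have "swp (\<lambda>x y. jac m b a (1 - x - y) x) = (\<lambda>x y. jac m b a (1 - x - y) y)"
    unfolding swp_def by (rule flip_z)
  then show ?thesis using Eig_swp[OF jac_zx_Eig[of m b a c]] by simp
qed

text \<open>Only the open edge is available, since the factor multiplying \<open>jac\<close> on it
  vanishes at the endpoints. Continuity carries the identity to the endpoint u = 1, where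
  \<open>jac\<close> is nonzero.\<close>

lemma jac_edge_nonzero:
  assumes "b > -1" and z: "\<And>u. 0 < u \<Longrightarrow> u < 1 \<Longrightarrow> k * jac m b a u (1 - u) = 0"
  shows "k = 0"
proof -
  define g where "g u = k * jac m b a u (1 - u)" for u
  have "isCont g 1" unfolding g_def jac_def by (intro continuous_intros)
  then have "(g \<longlongrightarrow> g 1) (at_left 1)" unfolding isCont_def by (rule tendsto_within_subset) auto
  moreover have "eventually (\<lambda>u. g u = 0) (at_left 1)"
    unfolding g_def using z by (intro eventually_at_leftI[of 0]) auto
  then have "(g \<longlongrightarrow> 0) (at_left 1)" by (rule tendsto_eventually)
  ultimately have "g 1 = 0" by (rule tendsto_unique[rotated]) simp
  then show ?thesis using jac_1_0_nonzero[OF assms(1)] by (simp add: g_def)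
qed

lemma Vsp_cases:
  assumes "a > -1" "b > -1" "c > -1" "f \<in> Vsp (int n - 1) a b c"
  shows "f = (\<lambda>x y. 0) \<or> (\<exists>m. n = Suc m \<and> f \<in> Eig a b c m)"
proof (cases n)
  case (Suc m)
  then have "int n - 1 = int m" by simp
  with assms have "f \<in> Eig a b c m" by (simp add: Vsp_eq_Eig)
  with Suc show ?thesis by blast
qed (use assms(4) in \<open>simp add: Vsp_neg\<close>)

lemma has_dim_Vsp:
  assumes "a > -1" "b > -1" "c > -1"
  shows "has_dim (Vsp (int n - 1) a b c) n"
proof (cases n)
  case (Suc m)
  have "has_dim (Eig a b c m) (Suc m)" using assms eigval_neq_of_gt by (intro has_dim_Eig) auto
  moreover have "int n - 1 = int m" using Suc by simp
  ultimately show ?thesis using assms Suc by (simp add: Vsp_eq_Eig)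
qed (simp add: Vsp_neg has_dim_zero)

lemma Vsp_poly2: "a > -1 \<Longrightarrow> b > -1 \<Longrightarrow> c > -1 \<Longrightarrow> f \<in> Vsp (int n - 1) a b c \<Longrightarrow> poly2 f"
  using Vsp_cases poly2_zero EigD(2) by blast

lemma UpropsI:
  assumes U: "U \<subseteq> Eig a b c n" and ne: "\<And>k. k < n \<Longrightarrow> eigval a b c k \<noteq> eigval a b c n"
    and "has_dim U (Suc n)"
  shows "Uprops n a b c U"
  unfolding Uprops_def
proof (intro conjI ballI impI allI notI)
  show "poly_le n u" if "u \<in> U" for u using that U EigD(1) poly_le_iff_plt by blast
  show "Lop a b c u x y = - (real n * (real n + a + b + c + 2)) * u x y" if "u \<in> U" for u x y
    using that U EigD(3)[of u a b c n x y] by (auto simp: eigval_def)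
  show False if "u \<in> U" "u \<noteq> (\<lambda>x y. 0)" "m < n" "poly_le m u" for u m
    using Eig_lower_degree_zero[of u a b c n "Suc m"] that U ne poly_le_iff_plt by auto
qed (use assms(3) in simp)

section \<open>The three cases\<close>

lemma Ua_case:
  assumes "\<alpha> > -1" "\<beta> > -1"
  shows "Uprops n \<alpha> \<beta> (-1) (Ua \<alpha> \<beta> n) \<and> direct (Ua_list \<alpha> \<beta> n)"
proof -
  define J where "J = jac n \<beta> \<alpha>"
  define V where "V = mulsp (\<lambda>x y. 1 - x - y) (Vsp (int n - 1) \<alpha> \<beta> 1)"
  have list: "Ua_list \<alpha> \<beta> n = [V, ray J]"
    unfolding Ua_list_def V_def J_def H3_eq ..
  have J10: "J 1 0 \<noteq> 0" unfolding J_def using assms by (intro jac_1_0_nonzero)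
  have dV: "has_dim V n" unfolding V_def
    using assms by (intro has_dim_mulsp has_dim_Vsp Vsp_poly2) auto
  have dJ: "has_dim (ray J) 1" using J10 by (intro has_dim_ray) auto
  have "direct [V, ray J] \<and> has_dim (sumsp [V, ray J]) (n + 1)"
  proof (rule sumsp_Cons_direct[OF dV sumsp_single_direct[OF dJ]])
    fix f g assume "f \<in> V" "g \<in> sumsp [ray J]" and z: "\<forall>x y. f x y + g x y = 0"
    then obtain v k where f: "f = (\<lambda>x y. (1 - x - y) * v x y)" and g: "g = (\<lambda>x y. k * J x y)"
      unfolding V_def mulsp_def sumsp_Cons sumsp_Nil ray_def by auto
    \<comment> \<open>The vertex (1, 0) lies on the edge 1 - x - y = 0, where \<open>V\<close>
      vanishes.\<close>
    have "k = 0" using z[rule_format, of 1 0] J10 by (simp add: f g)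
    then show "f = (\<lambda>x y. 0)" using z by (simp add: f g fun_eq_iff)
  qed
  moreover have "sumsp [V, ray J] \<subseteq> Eig \<alpha> \<beta> (-1) n"
  proof (rule sumsp_subset_Eig)
    fix A assume "A \<in> set [V, ray J]"
    moreover have "ray J \<subseteq> Eig \<alpha> \<beta> (-1) n" unfolding J_def by (intro ray_subset_Eig jac_Eig)
    moreover have "f \<in> Eig \<alpha> \<beta> (-1) n" if fV: "f \<in> V" for f
    proof -
      obtain v where f: "f = (\<lambda>x y. (1 - x - y) * v x y)" and v: "v \<in> Vsp (int n - 1) \<alpha> \<beta> 1"
        using fV unfolding V_def mulsp_def by auto
      show ?thesis using Vsp_cases[OF assms _ v] Eig_mult_z Eig_zero unfolding f by auto
    qed
    ultimately show "A \<subseteq> Eig \<alpha> \<beta> (-1) n" by auto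
  qed
  ultimately show ?thesis
    unfolding Ua_def list using assms by (intro conjI UpropsI eigval_neq) auto
qed

lemma Uprops_const: "Uprops 0 a b c {\<lambda>x y. k | k. True}"
proof -
  have "{\<lambda>x y. k | k. True} = ray (\<lambda>x y. 1)" unfolding ray_def by simp
  moreover have "Uprops 0 a b c (ray (\<lambda>x y. 1))"
  proof (rule UpropsI)
    have "(\<lambda>x y. 1) \<in> Eig a b c 0"
      by (rule EigI) (auto simp: plt_const Lop_def dx_const dy_const eigval_def)
    then show "ray (\<lambda>x y. 1) \<subseteq> Eig a b c 0" by (rule ray_subset_Eig)
    show "has_dim (ray (\<lambda>x y. 1)) (Suc 0)" using has_dim_ray[of "\<lambda>x y. 1"] by (simp add: fun_eq_iff)
  qed simp
  ultimately show ?thesis by simp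
qed

lemma Ub_case:
  assumes "\<alpha> > -1"
  shows "Uprops n \<alpha> (-1) (-1) (Ub \<alpha> n) \<and> (n \<ge> 1 \<longrightarrow> direct (Ub_list \<alpha> n))"
proof (cases n)
  case 0
  then show ?thesis using Uprops_const[of \<alpha> "-1" "-1"] by (simp add: Ub_def)
next
  case (Suc m)
  define J where "J = (\<lambda>x y. y * jac m 1 \<alpha> x y)"
  define K where "K = (\<lambda>x y. (1 - x - y) * jac m \<alpha> 1 (1 - x - y) x)"
  define V where "V = mulsp (\<lambda>x y. y * (1 - x - y)) (Vsp (int m - 1) \<alpha> 1 1)"
  have i: "int n - 1 = int m" "int n - 2 = int m - 1" using Suc by auto
  have list: "Ub_list \<alpha> n = [V, ray J, ray K]"
    unfolding Ub_list_def V_def J_def K_def i H3_eq H2_eq mulsp_ray ..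
  have J: "J 0 1 \<noteq> 0" unfolding J_def using jac_0_1_nonzero[OF assms] by simp
  have K: "K 0 0 \<noteq> 0" unfolding K_def using jac_1_0_nonzero[OF assms] by simp
  have dV: "has_dim V m" unfolding V_def
    using assms by (intro has_dim_mulsp has_dim_Vsp Vsp_poly2[of \<alpha> 1 1]) auto
  have dJ: "has_dim (ray J) 1" using J by (intro has_dim_ray) auto
  have dK: "has_dim (ray K) 1" using K by (intro has_dim_ray) auto
  have dJK: "direct [ray J, ray K] \<and> has_dim (sumsp [ray J, ray K]) (1 + 1)"
  proof (rule sumsp_Cons_direct[OF dJ sumsp_single_direct[OF dK]])
    fix f g assume "f \<in> ray J" "g \<in> sumsp [ray K]" and z: "\<forall>x y. f x y + g x y = 0"
    then obtain k l where f: "f = (\<lambda>x y. k * J x y)" and g: "g = (\<lambda>x y. l * K x y)"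
      unfolding sumsp_Cons sumsp_Nil ray_def by auto
    \<comment> \<open>The factor 1 - x - y removes \<open>K\<close> at the vertex (0, 1).\<close>
    have "k = 0" using z[rule_format, of 0 1] J by (simp add: f g K_def)
    then show "f = (\<lambda>x y. 0)" by (simp add: f)
  qed
  have "direct [V, ray J, ray K] \<and> has_dim (sumsp [V, ray J, ray K]) (m + (1 + 1))"
  proof (rule sumsp_Cons_direct[OF dV dJK])
    fix f g assume "f \<in> V" "g \<in> sumsp [ray J, ray K]" and z: "\<forall>x y. f x y + g x y = 0"
    then obtain v k l where f: "f = (\<lambda>x y. y * (1 - x - y) * v x y)" and g: "g = (\<lambda>x y. k * J x y + l * K x y)"
      unfolding V_def mulsp_def sumsp_Cons sumsp_Nil ray_def by auto
    have k: "k = 0" using z[rule_format, of 0 1] J by (simp add: f g K_def)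
    \<comment> \<open>At the origin the factor y removes both \<open>V\<close> and
      \<open>J\<close>.\<close>
    have "l = 0" using z[rule_format, of 0 0] K by (simp add: f g J_def)
    then show "f = (\<lambda>x y. 0)" using z k by (simp add: f g fun_eq_iff)
  qed
  moreover have "sumsp [V, ray J, ray K] \<subseteq> Eig \<alpha> (-1) (-1) n"
  proof (rule sumsp_subset_Eig)
    fix A assume "A \<in> set [V, ray J, ray K]"
    moreover have "ray J \<subseteq> Eig \<alpha> (-1) (-1) n"
      unfolding J_def Suc by (intro ray_subset_Eig Eig_mult_y jac_Eig)
    moreover have "ray K \<subseteq> Eig \<alpha> (-1) (-1) n"
      unfolding K_def Suc by (intro ray_subset_Eig Eig_mult_z jac_zx_Eig)
    moreover have "f \<in> Eig \<alpha> (-1) (-1) n" if fV: "f \<in> V" for f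
    proof -
      obtain v where f: "f = (\<lambda>x y. y * ((1 - x - y) * v x y))" and v: "v \<in> Vsp (int m - 1) \<alpha> 1 1"
        using fV unfolding V_def mulsp_def by (auto simp: mult.assoc)
      show ?thesis using Vsp_cases[OF assms _ _ v] Eig_mult_y[OF Eig_mult_z] Eig_zero unfolding f Suc by auto
    qed
    ultimately show "A \<subseteq> Eig \<alpha> (-1) (-1) n" by auto
  qed
  ultimately have "Uprops n \<alpha> (-1) (-1) (sumsp (Ub_list \<alpha> n)) \<and> direct (Ub_list \<alpha> n)"
    unfolding list using assms Suc by (intro conjI UpropsI eigval_neq) auto
  then show ?thesis using Suc by (simp add: Ub_def)
qed

text \<open>For parameters -1 all first-order coefficients of \<open>Lop\<close> vanish, so it
  annihilates every linear polynomial. The eigenvalue is 0 for degrees 0 and 1 alike, hence the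
  exact degree is checked directly.\<close>

lemma Uc_linear_case: "Uprops 1 (-1) (-1) (-1) {\<lambda>x y. k1 * (x + c1) + k2 * (y + c2) | k1 k2. True}"
  unfolding Uprops_def
proof (intro conjI ballI impI allI notI)
  let ?U = "{\<lambda>x y. k1 * (x + c1) + k2 * (y + c2) | k1 k2. True} :: bfun set"
  fix u assume "u \<in> ?U"
  then obtain k1 k2 where u: "u = (\<lambda>x y. k1 * (x + c1) + k2 * (y + c2))" by blast
  show "poly_le 1 u"
    unfolding poly_le_iff_plt u One_nat_def
    by (intro plt_add plt_scale plt_x plt_y plt_const)
  show "Lop (-1) (-1) (-1) u x y = - (real 1 * (real 1 + - 1 + - 1 + - 1 + 2)) * u x y" for x y
  proof -
    have "dx u = (\<lambda>x y. k1)" "dy u = (\<lambda>x y. k2)"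
      unfolding u by (auto intro!: dx_eqI dy_eqI derivative_eq_intros)
    then show ?thesis by (simp add: Lop_def dx_const dy_const)
  qed
  fix m :: nat assume "u \<noteq> (\<lambda>x y. 0)" "m < 1" "poly_le m u"
  then obtain k where "\<And>x y. u x y = k" unfolding poly_le_def by auto
  then have "u 1 0 = u 0 0" "u 0 1 = u 0 0" by simp_all
  then have "k1 = 0" "k2 = 0" unfolding u by (simp_all add: algebra_simps)
  with \<open>u \<noteq> (\<lambda>x y. 0)\<close> show False by (simp add: u)
next
  have two: "(\<Sum>i<1 + 1. F i) = F 0 + F 1" for F :: "nat \<Rightarrow> real"
    by (simp add: numeral_2_eq_2)
  show "has_dim {\<lambda>x y. k1 * (x + c1) + k2 * (y + c2) | k1 k2. True} (1 + 1)"
    unfolding has_dim_iff two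
  proof (intro exI[of _ "\<lambda>i x y. if i = 0 then x + c1 else y + c2"] conjI allI impI)
    fix c :: "nat \<Rightarrow> real" and i :: nat
    assume z: "\<forall>x y. (c 0 * (if (0::nat) = 0 then x + c1 else y + c2) + c 1 * (if (1::nat) = 0 then x + c1 else y + c2)) = 0" and i: "i < 1 + 1"
    have "c 0 * (x + c1) + c 1 * (y + c2) = 0" for x y using z by simp
    \<comment> \<open>Each point makes one of the two basis functions 0 and the other 1.\<close>
    from this[of "- c1" "1 - c2"] this[of "1 - c1" "- c2"] have "c 0 = 0" "c 1 = 0" by auto
    then show "c i = 0" using i by (cases i) auto
  next
    show "{\<lambda>x y. k1 * (x + c1) + k2 * (y + c2) | k1 k2. True} =
      {\<lambda>x y. c 0 * (if (0::nat) = 0 then x + c1 else y + c2) + c 1 * (if (1::nat) = 0 then x + c1 else y + c2) |c :: nat \<Rightarrow> real. True}"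
    proof (intro equalityI subsetI)
      fix u assume "u \<in> {\<lambda>x y. k1 * (x + c1) + k2 * (y + c2) | k1 k2. True}"
      then obtain k1 k2 where "u = (\<lambda>x y. k1 * (x + c1) + k2 * (y + c2))" by blast
      then show "u \<in> {\<lambda>x y. c 0 * (if (0::nat) = 0 then x + c1 else y + c2) + c 1 * (if (1::nat) = 0 then x + c1 else y + c2) |c :: nat \<Rightarrow> real. True}"
        by (intro CollectI exI[of _ "\<lambda>i. if i = 0 then k1 else k2"]) simp
    next
      fix u assume "u \<in> {\<lambda>x y. c 0 * (if (0::nat) = 0 then x + c1 else y + c2) + c 1 * (if (1::nat) = 0 then x + c1 else y + c2) |c :: nat \<Rightarrow> real. True}"
      then show "u \<in> {\<lambda>x y. k1 * (x + c1) + k2 * (y + c2) | k1 k2. True}" by auto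
    qed
  qed
qed

lemma Uc_sum_case:
  assumes n: "n = Suc (Suc m)"
  shows "Uprops n (-1) (-1) (-1) (sumsp (Uc_list n)) \<and> direct (Uc_list n)"
proof -
  define J where "J = (\<lambda>x y. x * y * jac m 1 1 x y)"
  define K where "K = (\<lambda>x y. x * (1 - x - y) * jac m 1 1 (1 - x - y) x)"
  define L where "L = (\<lambda>x y. y * (1 - x - y) * jac m 1 1 (1 - x - y) y)"
  define V where "V = mulsp (\<lambda>x y. x * y * (1 - x - y)) (Vsp (int m - 1) 1 1 1)"
  have i: "int n - 2 = int m" "int n - 3 = int m - 1" using n by auto
  have list: "Uc_list n = [V, ray J, ray K, ray L]"
    unfolding Uc_list_def V_def J_def K_def L_def i H3_eq H2_eq H1_eq mulsp_ray ..
  have J: "k = 0" if "\<And>x. 0 < x \<Longrightarrow> x < 1 \<Longrightarrow> k * J x (1 - x) = 0" for k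
  proof (rule jac_edge_nonzero)
    show "k * jac m 1 1 u (1 - u) = 0" if "0 < u" "u < 1" for u
      using \<open>\<And>x. 0 < x \<Longrightarrow> x < 1 \<Longrightarrow> k * J x (1 - x) = 0\<close>[OF that] that by (simp add: J_def)
  qed simp
  have K: "k = 0" if "\<And>x. 0 < x \<Longrightarrow> x < 1 \<Longrightarrow> k * K x 0 = 0" for k
  proof (rule jac_edge_nonzero)
    show "k * jac m 1 1 u (1 - u) = 0" if "0 < u" "u < 1" for u
      \<comment> \<open>On the edge y = 0 the arguments of \<open>jac\<close> are 1 - x and x, hence
        the substitution x = 1 - u.\<close>
      using \<open>\<And>x. 0 < x \<Longrightarrow> x < 1 \<Longrightarrow> k * K x 0 = 0\<close>[of "1 - u"] that by (simp add: K_def)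
  qed simp
  have L: "k = 0" if "\<And>y. 0 < y \<Longrightarrow> y < 1 \<Longrightarrow> k * L 0 y = 0" for k
  proof (rule jac_edge_nonzero)
    show "k * jac m 1 1 u (1 - u) = 0" if "0 < u" "u < 1" for u
      using \<open>\<And>y. 0 < y \<Longrightarrow> y < 1 \<Longrightarrow> k * L 0 y = 0\<close>[of "1 - u"] that by (simp add: L_def)
  qed simp
  have dV: "has_dim V m" unfolding V_def
    by (intro has_dim_mulsp has_dim_Vsp Vsp_poly2[of 1 1 1]) auto
  have dJ: "has_dim (ray J) 1" using J[of 1] by (intro has_dim_ray) auto
  have dK: "has_dim (ray K) 1" using K[of 1] by (intro has_dim_ray) auto
  have dL: "has_dim (ray L) 1" using L[of 1] by (intro has_dim_ray) auto
  \<comment> \<open>Each generator vanishes on two edges, and \<open>V\<close> on all three, so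
    restriction to an edge isolates one coefficient.\<close>
  have edges: "J x 0 = 0" "J 0 y = 0" "K x (1 - x) = 0" "K 0 y = 0" "L x (1 - x) = 0" "L x 0 = 0" for x y
    by (simp_all add: J_def K_def L_def)
  have dKL: "direct [ray K, ray L] \<and> has_dim (sumsp [ray K, ray L]) (1 + 1)"
  proof (rule sumsp_Cons_direct[OF dK sumsp_single_direct[OF dL]])
    fix f g assume "f \<in> ray K" "g \<in> sumsp [ray L]" and z: "\<forall>x y. f x y + g x y = 0"
    then obtain k l where f: "f = (\<lambda>x y. k * K x y)" and g: "g = (\<lambda>x y. l * L x y)"
      unfolding sumsp_Cons sumsp_Nil ray_def by auto
    have "k = 0" by (rule K) (use z edges in \<open>metis f g add.right_neutral mult_zero_right\<close>)
    then show "f = (\<lambda>x y. 0)" by (simp add: f)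
  qed
  have dJKL: "direct [ray J, ray K, ray L] \<and> has_dim (sumsp [ray J, ray K, ray L]) (1 + (1 + 1))"
  proof (rule sumsp_Cons_direct[OF dJ dKL])
    fix f g assume "f \<in> ray J" "g \<in> sumsp [ray K, ray L]" and z: "\<forall>x y. f x y + g x y = 0"
    then obtain j k l where f: "f = (\<lambda>x y. j * J x y)" and g: "g = (\<lambda>x y. k * K x y + l * L x y)"
      unfolding sumsp_Cons sumsp_Nil ray_def by auto
    have "j = 0"
    proof (rule J)
      show "j * J x (1 - x) = 0" for x using z[rule_format, of x "1 - x"] by (simp add: f g edges)
    qed
    then show "f = (\<lambda>x y. 0)" by (simp add: f)
  qed
  have "direct [V, ray J, ray K, ray L] \<and> has_dim (sumsp [V, ray J, ray K, ray L]) (m + (1 + (1 + 1)))"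
  proof (rule sumsp_Cons_direct[OF dV dJKL])
    fix f g assume "f \<in> V" "g \<in> sumsp [ray J, ray K, ray L]" and z: "\<forall>x y. f x y + g x y = 0"
    then obtain v j k l where f: "f = (\<lambda>x y. x * y * (1 - x - y) * v x y)"
      and g: "g = (\<lambda>x y. j * J x y + (k * K x y + l * L x y))"
      unfolding V_def mulsp_def sumsp_Cons sumsp_Nil ray_def by auto
    have "j = 0"
    proof (rule J)
      show "j * J x (1 - x) = 0" for x using z[rule_format, of x "1 - x"] by (simp add: f g edges)
    qed
    moreover have "k = 0"
    proof (rule K)
      show "k * K x 0 = 0" for x using z[rule_format, of x 0] by (simp add: f g edges)
    qed
    moreover have "l = 0"
    proof (rule L)
      show "l * L 0 y = 0" for y using z[rule_format, of 0 y] by (simp add: f g edges)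
    qed
    ultimately show "f = (\<lambda>x y. 0)" using z by (simp add: g fun_eq_iff)
  qed
  moreover have "sumsp [V, ray J, ray K, ray L] \<subseteq> Eig (-1) (-1) (-1) n"
  proof (rule sumsp_subset_Eig)
    fix A assume "A \<in> set [V, ray J, ray K, ray L]"
    moreover have "ray J \<subseteq> Eig (-1) (-1) (-1) n"
      unfolding J_def n mult.assoc by (intro ray_subset_Eig Eig_mult_x Eig_mult_y jac_Eig)
    moreover have "ray K \<subseteq> Eig (-1) (-1) (-1) n"
      unfolding K_def n mult.assoc by (intro ray_subset_Eig Eig_mult_x Eig_mult_z jac_zx_Eig)
    moreover have "ray L \<subseteq> Eig (-1) (-1) (-1) n"
      unfolding L_def n mult.assoc by (intro ray_subset_Eig Eig_mult_y Eig_mult_z jac_zy_Eig)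
    moreover have "f \<in> Eig (-1) (-1) (-1) n" if fV: "f \<in> V" for f
    proof -
      obtain v where f: "f = (\<lambda>x y. x * (y * ((1 - x - y) * v x y)))" and v: "v \<in> Vsp (int m - 1) 1 1 1"
        using fV unfolding V_def mulsp_def by (auto simp: mult.assoc)
      show ?thesis
        using Vsp_cases[OF _ _ _ v] Eig_mult_x[OF Eig_mult_y[OF Eig_mult_z]] Eig_zero unfolding f n by auto
    qed
    ultimately show "A \<subseteq> Eig (-1) (-1) (-1) n" by auto
  qed
  ultimately show ?thesis
    unfolding list using n by (intro conjI UpropsI eigval_neq) auto
qed

theorem theorem3p1:
  fixes \<alpha> \<beta> c1 c2 :: real and n :: nat
  assumes "\<alpha> > -1" and "\<beta> > -1"
  shows "(Uprops n \<alpha> \<beta> (-1) (Ua \<alpha> \<beta> n) \<and> direct (Ua_list \<alpha> \<beta> n))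
    \<and> (Uprops n \<alpha> (-1) (-1) (Ub \<alpha> n) \<and> (n \<ge> 1 \<longrightarrow> direct (Ub_list \<alpha> n)))
    \<and> (Uprops n (-1) (-1) (-1) (Uc c1 c2 n) \<and> (n \<ge> 2 \<longrightarrow> direct (Uc_list n)))"
proof (intro conjI)
  consider "n = 0" | "n = 1" | m where "n = Suc (Suc m)"
    by (metis One_nat_def not0_implies_Suc)
  then have "Uprops n (-1) (-1) (-1) (Uc c1 c2 n) \<and> (n \<ge> 2 \<longrightarrow> direct (Uc_list n))"
  proof cases
    case 1
    then show ?thesis using Uprops_const[of "-1" "-1" "-1"] by (simp add: Uc_def)
  next
    case 2
    then show ?thesis using Uc_linear_case by (simp add: Uc_def)
  next
    case (3 m)
    then show ?thesis using Uc_sum_case[OF 3] by (simp add: Uc_def)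
  qed
  then show "Uprops n (-1) (-1) (-1) (Uc c1 c2 n)" "n \<ge> 2 \<longrightarrow> direct (Uc_list n)" by auto
qed (use Ua_case[OF assms] Ub_case[OF assms(1)] in auto)

end
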